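(* For an elementary stellar subdivision $i\colon N\to M$ of an isolated $d$-simplex $N$ along a $k$-simplex (a $k$-face of $N$), the codimension one invariant value is $$C_{d-1}=\frac{1}{\sqrt{d+2}}.$$ In particular, it is identical for all (elementary) stellar subdivisions of an isolated $d$-simplex.
   Context: An isolated $d$-simplex is the simplicial complex consisting of a single $d$-simplex and all its faces. The elementary stellar subdivision of a complex along a $k$-simplex $s$ ($k\ge 1$) adds one new vertex $v$ in the interior of $s$ and replaces the star of $s$ by the cone from $v$ over (boundary of $s$) joined with (link of $s$). Chains are simplicial chains with real coefficients, with the standard inner product, for which the simplices are orthonormal. A subdivision $i\colon N\to M$ induces the injective chain map $i_*$ sending an oriented simplex of $N$ to the sum of the compatibly oriented simplices of $M$ of the same dimension subdividing it. In top dimension $d$, $V_d=(\operatorname{im} i_* )^\perp$ inside the $d$-chains of $M$ (standard inner product). For subspaces $X,Y$ of an inner product space, $\langle X,Y\rangle=\max\{(x,y):x\in X,\ y\in Y,\ |x|=|y|=1\}$. The codimension one invariant is $C_{d-1}=\langle\operatorname{im} i_*,\partial V_d\rangle$, with $\operatorname{im} i_*$ in degree $d-1$ and with respect to the standard inner product. *)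

theory Defs
  imports "HOL-Analysis.Analysis" "Jordan_Normal_Form.Determinant"
begin

text \<open>
  Geometric simplicial complexes as in the library (\<^const>\<open>simplicial_complex\<close>): sets of simplices,
  each given as the convex hull of its vertices, with the empty face as the \<open>(-1)\<close>-simplex.
\<close>

definition isolated_simplex :: "nat \<Rightarrow> 'a::euclidean_space set set \<Rightarrow> bool" where
  "isolated_simplex d N \<longleftrightarrow> (\<exists>S. int d simplex S \<and> N = {F. F face_of S})"

definition closed_star :: "'a::euclidean_space set set \<Rightarrow> 'a set \<Rightarrow> 'a set set" where
  "closed_star K s = {F. \<exists>S\<in>K. s face_of S \<and> F face_of S}"

definition simplex_link :: "'a::euclidean_space set set \<Rightarrow> 'a set \<Rightarrow> 'a set set" where
  "simplex_link K s = {F \<in> closed_star K s. F \<inter> s = {}}"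

definition boundary_complex :: "'a::euclidean_space set \<Rightarrow> 'a set set" where
  "boundary_complex s = {F. F face_of s \<and> F \<noteq> s}"

definition complex_join :: "'a::euclidean_space set set \<Rightarrow> 'a set set \<Rightarrow> 'a set set" where
  "complex_join A B = {convex hull (F \<union> G) | F G. F \<in> A \<and> G \<in> B}"

definition cone_over :: "'a::euclidean_space \<Rightarrow> 'a set set \<Rightarrow> 'a set set" where
  "cone_over v A = A \<union> {convex hull (insert v F) | F. F \<in> A}"

definition stellar_subdivision ::
  "'a::euclidean_space set set \<Rightarrow> 'a set \<Rightarrow> 'a \<Rightarrow> 'a set set" where
  "stellar_subdivision K s v =
     (K - closed_star K s) \<union> cone_over v (complex_join (boundary_complex s) (simplex_link K s))"

definition elementary_stellar_subdivision ::
  "nat \<Rightarrow> 'a::euclidean_space set set \<Rightarrow> 'a set set \<Rightarrow> bool" where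
  "elementary_stellar_subdivision k K M \<longleftrightarrow>
     1 \<le> k \<and> (\<exists>s\<in>K. \<exists>v\<in>rel_interior s. int k simplex s \<and> M = stellar_subdivision K s v)"

definition simplices :: "'a::euclidean_space set set \<Rightarrow> nat \<Rightarrow> 'a set set" where
  "simplices K p = {S \<in> K. int p simplex S}"

text \<open>
  An orientation of a complex picks an ordering of the vertices of each simplex of dimension at
  least 0.  A chain is then the family of coefficients with respect to the simplices so oriented.
\<close>

definition simplex_vertices :: "'a::euclidean_space set \<Rightarrow> 'a set" where
  "simplex_vertices S = {x. x extreme_point_of S}"

definition complex_orientation ::
  "'a::euclidean_space set set \<Rightarrow> ('a set \<Rightarrow> 'a list) \<Rightarrow> bool" where
  "complex_orientation K ori \<longleftrightarrow>
     (\<forall>p. \<forall>S\<in>simplices K p. distinct (ori S) \<and> set (ori S) = simplex_vertices S)"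

text \<open>
  Row \<open>j\<close> of \<open>A\<close> holds the barycentric coordinates of \<open>ys ! j\<close> with respect to \<open>xs\<close>, so
  \<open>det A\<close> is the determinant of the linear part of the affine map taking \<open>xs\<close> to \<open>ys\<close>.  If
  \<open>ys\<close> is a reordering of \<open>xs\<close>, then \<open>A\<close> is a permutation matrix and \<open>det A\<close> is the
  sign of the permutation.
\<close>

definition compatibly_oriented :: "'a::euclidean_space list \<Rightarrow> 'a list \<Rightarrow> bool" where
  "compatibly_oriented xs ys \<longleftrightarrow>
     (\<exists>A \<in> carrier_mat (length xs) (length xs).
        length ys = length xs \<and>
        (\<forall>j<length ys. (\<Sum>i<length xs. A $$ (j, i)) = 1 \<and>
                       ys ! j = (\<Sum>i<length xs. A $$ (j, i) *\<^sub>R xs ! i)) \<and>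
        Determinant.det A > (0::real))"

text \<open>Meaningful for affinely independent vertex lists with the same affine hull.\<close>

definition relative_sign :: "'a::euclidean_space list \<Rightarrow> 'a list \<Rightarrow> real" where
  "relative_sign xs ys = (if compatibly_oriented xs ys then 1 else - 1)"

definition chains :: "'a::euclidean_space set set \<Rightarrow> nat \<Rightarrow> ('a set \<Rightarrow> real) set" where
  "chains K p = {c. \<forall>S. S \<notin> simplices K p \<longrightarrow> c S = 0}"

definition chain_inner ::
  "'a::euclidean_space set set \<Rightarrow> nat \<Rightarrow> ('a set \<Rightarrow> real) \<Rightarrow> ('a set \<Rightarrow> real) \<Rightarrow> real" where
  "chain_inner K p c e = (\<Sum>S\<in>simplices K p. c S * e S)"

definition omit_nth :: "nat \<Rightarrow> 'a list \<Rightarrow> 'a list" where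
  "omit_nth i xs = take i xs @ drop (Suc i) xs"

text \<open>The coefficient of the oriented simplex \<open>T\<close> in the boundary of the oriented simplex \<open>S\<close>.\<close>

definition incidence_number ::
  "('a::euclidean_space set \<Rightarrow> 'a list) \<Rightarrow> 'a set \<Rightarrow> 'a set \<Rightarrow> real" where
  "incidence_number ori S T =
     (\<Sum>i<length (ori S).
        if set (omit_nth i (ori S)) = simplex_vertices T
        then (- 1) ^ i * relative_sign (omit_nth i (ori S)) (ori T) else 0)"

text \<open>The boundary operator from \<open>(p + 1)\<close>-chains to \<open>p\<close>-chains.\<close>

definition chain_bd ::
  "('a::euclidean_space set \<Rightarrow> 'a list) \<Rightarrow> 'a set set \<Rightarrow> nat \<Rightarrow> ('a set \<Rightarrow> real) \<Rightarrow> ('a set \<Rightarrow> real)"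
  where
  "chain_bd ori K p c = (\<lambda>T. if T \<in> simplices K p
     then \<Sum>S\<in>simplices K (Suc p). c S * incidence_number ori S T else 0)"

definition subdivision_chain_map ::
  "('a::euclidean_space set \<Rightarrow> 'a list) \<Rightarrow> 'a set set \<Rightarrow> ('a set \<Rightarrow> 'a list) \<Rightarrow> 'a set set \<Rightarrow> nat \<Rightarrow>
   ('a set \<Rightarrow> real) \<Rightarrow> ('a set \<Rightarrow> real)" where
  "subdivision_chain_map oriN N oriM M p c = (\<lambda>T. if T \<in> simplices M p
     then \<Sum>S\<in>{S \<in> simplices N p. T \<subseteq> S}. c S * relative_sign (oriN S) (oriM T) else 0)"

definition subdivision_image ::
  "('a::euclidean_space set \<Rightarrow> 'a list) \<Rightarrow> 'a set set \<Rightarrow> ('a set \<Rightarrow> 'a list) \<Rightarrow> 'a set set \<Rightarrow> nat \<Rightarrow>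
   ('a set \<Rightarrow> real) set" where
  "subdivision_image oriN N oriM M p = subdivision_chain_map oriN N oriM M p ` chains N p"

definition subdivision_complement ::
  "('a::euclidean_space set \<Rightarrow> 'a list) \<Rightarrow> 'a set set \<Rightarrow> ('a set \<Rightarrow> 'a list) \<Rightarrow> 'a set set \<Rightarrow> nat \<Rightarrow>
   ('a set \<Rightarrow> real) set" where
  "subdivision_complement oriN N oriM M p =
     {y \<in> chains M p. \<forall>x\<in>subdivision_image oriN N oriM M p. chain_inner M p x y = 0}"

text \<open>\<open>GREATEST\<close> denotes an actual maximum; it is unspecified if there is none.\<close>

definition max_inner :: "('c \<Rightarrow> 'c \<Rightarrow> real) \<Rightarrow> 'c set \<Rightarrow> 'c set \<Rightarrow> real" where
  "max_inner ip X Y =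
     (GREATEST r. \<exists>x\<in>X. \<exists>y\<in>Y. sqrt (ip x x) = 1 \<and> sqrt (ip y y) = 1 \<and> r = ip x y)"

text \<open>The invariant \<open>C\<^sub>d\<^sub>-\<^sub>1\<close> of a subdivision \<open>M\<close> of \<open>N\<close>; here \<open>d \<ge> 1\<close> is the common dimension.\<close>

definition codim_one_invariant ::
  "nat \<Rightarrow> ('a::euclidean_space set \<Rightarrow> 'a list) \<Rightarrow> 'a set set \<Rightarrow> ('a set \<Rightarrow> 'a list) \<Rightarrow> 'a set set \<Rightarrow> real"
  where
  "codim_one_invariant d oriN N oriM M =
     max_inner (chain_inner M (d - 1))
       (subdivision_image oriN N oriM M (d - 1))
       (chain_bd oriM M (d - 1) ` subdivision_complement oriN N oriM M d)"

end

theory Submission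
  imports Defs
begin

text \<open>
  Let \<open>C\<close> be the vertex set of the simplex, \<open>A\<close> that of the face subdivided at \<open>v\<close>.  The top cells of the
  subdivision are spanned by \<open>v\<close> and \<open>C - {a}\<close>, for \<open>a \<in> A\<close>, so after orienting them compatibly an
  element of \<open>V\<^sub>d\<close> is a family \<open>(y\<^sub>a)\<close>, \<open>a \<in> A\<close>, with sum zero.  Each cell has \<open>d + 1\<close> facets, and every two
  cells share exactly one facet, in which they induce opposite orientations; hence the adjoint of the
  boundary operator takes \<open>\<partial>y\<close> to \<open>(d + 1) y\<^sub>a - (\<Sum>c \<noteq> a. y\<^sub>c) = (d + 2) y\<^sub>a\<close>, and
  \<open>\<bar>\<partial>y\<bar>\<^sup>2 = (d + 2) \<bar>y\<bar>\<^sup>2\<close>.  A face of the simplex opposite to a vertex outside \<open>A\<close> is orthogonal to \<open>\<partial>y\<close>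
  because the coefficients sum to zero, while a face opposite to \<open>a \<in> A\<close> is not subdivided and meets
  \<open>\<partial>y\<close> in \<open>\<plusminus>y\<^sub>a\<close>.  Cauchy-Schwarz thus gives the maximum \<open>\<bar>y\<bar> / \<bar>\<partial>y\<bar>\<close>.  Orientations are handled by
  expressing all signs through signed volumes of vertex lists in a fixed barycentric frame.
\<close>

section \<open>Signed volumes\<close>

lemma sum_nth_eq_sum_set:
  assumes "distinct xs"
  shows "(\<Sum>i<length xs. f (xs ! i)) = sum f (set xs)"
  using sum.reindex_bij_betw[OF bij_betw_nth[OF assms refl refl], of f] by simp

lemma affine_hull_set_coordinates:
  fixes xs :: "'a::real_vector list"
  assumes "distinct xs" "p \<in> affine hull set xs"
  obtains u where "(\<Sum>i<length xs. u i) = 1" "p = (\<Sum>i<length xs. u i *\<^sub>R xs ! i)"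
proof -
  obtain w where w: "sum w (set xs) = 1" "(\<Sum>x\<in>set xs. w x *\<^sub>R x) = p"
    using assms(2) by (auto simp: affine_hull_finite)
  show thesis
    by (rule that[of "\<lambda>i. w (xs ! i)"])
      (use w sum_nth_eq_sum_set[OF assms(1), of w] sum_nth_eq_sum_set[OF assms(1), of "\<lambda>x. w x *\<^sub>R x"]
        in simp_all)
qed

text \<open>Supplies a witness of the shape over which \<open>compatibly_oriented\<close>
  quantifies; the sign of its determinant is settled separately, by volumes.\<close>

lemma affine_hull_coordinate_matrix:
  fixes xs ys :: "'a::real_vector list"
  assumes "distinct xs" "set ys \<subseteq> affine hull set xs" "length ys = length xs"
  obtains A where "A \<in> carrier_mat (length xs) (length xs)"
    "\<And>j. j < length xs \<Longrightarrow> (\<Sum>i<length xs. A $$ (j, i)) = (1::real)"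
    "\<And>j. j < length xs \<Longrightarrow> ys ! j = (\<Sum>i<length xs. A $$ (j, i) *\<^sub>R xs ! i)"
proof -
  have "\<exists>u. (\<Sum>i<length xs. u i) = 1 \<and> ys ! j = (\<Sum>i<length xs. u i *\<^sub>R xs ! i)"
    if "j < length xs" for j
    using that assms by (metis affine_hull_set_coordinates nth_mem subsetD)
  then obtain U where U: "\<And>j. j < length xs \<Longrightarrow> (\<Sum>i<length xs. U j i) = 1"
      "\<And>j. j < length xs \<Longrightarrow> ys ! j = (\<Sum>i<length xs. U j i *\<^sub>R xs ! i)"
    by metis
  show thesis
    by (rule that[of "Matrix.mat (length xs) (length xs) (\<lambda>(j, i). U j i)"]) (use U in simp_all)
qed

section \<open>Lists with one entry removed\<close>

lemma length_omit_nth: "i < length xs \<Longrightarrow> length (omit_nth i xs) = length xs - 1"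
  by (simp add: omit_nth_def)

lemma nth_omit_nth:
  "i < length xs \<Longrightarrow> k < length xs - 1 \<Longrightarrow> omit_nth i xs ! k = (if k < i then xs ! k else xs ! Suc k)"
  by (simp add: omit_nth_def nth_append min_def)

lemma set_omit_nth:
  assumes "distinct xs" "i < length xs"
  shows "set (omit_nth i xs) = set xs - {xs ! i}"
proof -
  have "xs = take i xs @ xs ! i # drop (Suc i) xs"
    using assms(2) by (rule id_take_nth_drop)
  then show ?thesis
    using assms(1) unfolding omit_nth_def
    by (metis Diff_insert_absorb Un_insert_right distinct.simps(2) distinct_append
        list.simps(15) set_append disjoint_insert(1) Un_iff)
qed

lemma distinct_omit_nth: "distinct xs \<Longrightarrow> distinct (omit_nth i xs)"
  unfolding omit_nth_def by (simp add: set_take_disj_set_drop_if_distinct)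

section \<open>Barycentric coordinates in a fixed frame\<close>

locale barycentric_frame =
  fixes X :: "'a::euclidean_space list"
  assumes distinct_frame: "distinct X"
    and independent_frame: "\<not> affine_dependent (set X)"
begin

abbreviation "n \<equiv> length X"
abbreviation "H \<equiv> affine hull set X"

text \<open>Junk for points outside \<^term>\<open>H\<close>.\<close>

definition bary :: "'a \<Rightarrow> nat \<Rightarrow> real" where
  "bary p = (SOME u. (\<Sum>i<n. u i) = 1 \<and> p = (\<Sum>i<n. u i *\<^sub>R X ! i))"

lemma bary:
  assumes "p \<in> H"
  shows "(\<Sum>i<n. bary p i) = 1" "(\<Sum>i<n. bary p i *\<^sub>R X ! i) = p"
proof -
  have "\<exists>u. (\<Sum>i<n. u i) = 1 \<and> p = (\<Sum>i<n. u i *\<^sub>R X ! i)"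
    using affine_hull_set_coordinates[OF distinct_frame assms] by metis
  from someI_ex[OF this] show "(\<Sum>i<n. bary p i) = 1" "(\<Sum>i<n. bary p i *\<^sub>R X ! i) = p"
    by (simp_all add: bary_def)
qed

text \<open>The difference of two coordinate families has sum zero and combines the frame points to
  zero, so a nonzero entry would exhibit an affine dependence of the frame.\<close>

lemma bary_unique:
  assumes p: "p \<in> H" and u: "(\<Sum>i<n. u i) = 1" "(\<Sum>i<n. u i *\<^sub>R X ! i) = p" and "i < n"
  shows "bary p i = u i"
proof (rule ccontr)
  assume neq: "bary p i \<noteq> u i"
  \<comment> \<open>\<open>affine_dependent\<close> speaks of weights on points, whereas coordinates
    are indexed by positions; the inverse of \<open>(!) X\<close> carries the difference
    over.\<close>
  define f where "f x = bary p (the_inv_into {..<n} ((!) X) x) - u (the_inv_into {..<n} ((!) X) x)" for x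
  have inj: "inj_on ((!) X) {..<n}"
    using distinct_frame by (simp add: inj_on_nth)
  have f: "f (X ! j) = bary p j - u j" if "j < n" for j
    using that by (simp add: f_def the_inv_into_f_f[OF inj])
  have "sum f (set X) = (\<Sum>j<n. bary p j - u j)"
    by (simp add: f flip: sum_nth_eq_sum_set[OF distinct_frame])
  then have "sum f (set X) = 0"
    by (simp add: sum_subtractf bary(1)[OF p] u)
  moreover have "(\<Sum>x\<in>set X. f x *\<^sub>R x) = (\<Sum>j<n. (bary p j - u j) *\<^sub>R X ! j)"
    by (simp add: f flip: sum_nth_eq_sum_set[OF distinct_frame])
  then have "(\<Sum>x\<in>set X. f x *\<^sub>R x) = 0"
    by (simp add: sum_subtractf bary(2)[OF p] u scaleR_left_diff_distrib)
  moreover have "f (X ! i) \<noteq> 0"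
    using neq f assms(4) by simp
  ultimately have "affine_dependent (set X)"
    unfolding affine_dependent_explicit_finite[OF finite_set] using assms(4) nth_mem by blast
  then show False
    using independent_frame by blast
qed

text \<open>The combined coefficients again have sum one and represent \<open>p\<close>, so
  uniqueness identifies them with its coordinates. This is what turns affine maps into matrix
  products.\<close>

lemma bary_affine_combination:
  assumes "\<And>l. l \<in> I \<Longrightarrow> q l \<in> H" "sum c I = 1" "p = (\<Sum>l\<in>I. c l *\<^sub>R q l)" "p \<in> H" "i < n"
  shows "bary p i = (\<Sum>l\<in>I. c l * bary (q l) i)"
proof (rule bary_unique)
  show "p \<in> H" "i < n"
    using assms by auto
  have "(\<Sum>i<n. \<Sum>l\<in>I. c l * bary (q l) i) = (\<Sum>l\<in>I. c l * (\<Sum>i<n. bary (q l) i))"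
    by (subst sum.swap) (simp add: sum_distrib_left)
  also have "\<dots> = 1"
    using assms(1,2) by (simp add: bary(1))
  finally show "(\<Sum>i<n. \<Sum>l\<in>I. c l * bary (q l) i) = 1" .
  have "(\<Sum>i<n. (\<Sum>l\<in>I. c l * bary (q l) i) *\<^sub>R X ! i) = (\<Sum>l\<in>I. c l *\<^sub>R (\<Sum>i<n. bary (q l) i *\<^sub>R X ! i))"
    unfolding scaleR_sum_left by (subst sum.swap) (simp add: scaleR_sum_right)
  also have "\<dots> = p"
    using assms(1,3) by (simp add: bary(2))
  finally show "(\<Sum>i<n. (\<Sum>l\<in>I. c l * bary (q l) i) *\<^sub>R X ! i) = p" .
qed

section \<open>Coordinate matrices and signed volumes\<close>

definition bary_mat :: "'a list \<Rightarrow> real Matrix.mat" where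
  "bary_mat ys = Matrix.mat n n (\<lambda>(j, i). bary (ys ! j) i)"

text \<open>The signed volume of the simplex \<^term>\<open>ys\<close> relative to the frame; only meaningful if
  \<^term>\<open>ys\<close> consists of \<^term>\<open>n\<close> points of \<^term>\<open>H\<close>.\<close>

definition vol :: "'a list \<Rightarrow> real" where
  "vol ys = Determinant.det (bary_mat ys)"

lemma bary_mat_carrier [simp]: "bary_mat ys \<in> carrier_mat n n"
  by (simp add: bary_mat_def)

lemma bary_mat_affine_map:
  assumes A: "A \<in> carrier_mat n n" "\<And>j. j < n \<Longrightarrow> (\<Sum>i<n. A $$ (j, i)) = 1"
    and ys: "\<And>j. j < n \<Longrightarrow> ys ! j = (\<Sum>i<n. A $$ (j, i) *\<^sub>R xs ! i)"
    and H: "set xs \<subseteq> H" "set ys \<subseteq> H" "length xs = n" "length ys = n"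
  shows "bary_mat ys = A * bary_mat xs"
proof (rule eq_matI)
  fix j i assume "j < dim_row (A * bary_mat xs)" "i < dim_col (A * bary_mat xs)"
  then have ji: "j < n" "i < n"
    using A by (simp_all add: bary_mat_def)
  have "bary (ys ! j) i = (\<Sum>l<n. A $$ (j, l) * bary (xs ! l) i)"
  proof (rule bary_affine_combination)
    show "ys ! j \<in> H"
      using ji H by (simp add: subset_iff)
    show "xs ! l \<in> H" if "l \<in> {..<n}" for l
      using that H by (simp add: subset_iff)
  qed (use ji A ys in auto)
  then show "bary_mat ys $$ (j, i) = (A * bary_mat xs) $$ (j, i)"
    using ji A by (simp add: bary_mat_def scalar_prod_def row_def col_def atLeast0LessThan)
qed (use A in \<open>simp_all add: bary_mat_def\<close>)

text \<open>Coordinates compose by matrix multiplication, so the determinant of an affine map is the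
  quotient of the two volumes whenever \<open>vol xs\<close> is nonzero.\<close>

lemma vol_affine_map:
  assumes "A \<in> carrier_mat n n" "\<And>j. j < n \<Longrightarrow> (\<Sum>i<n. A $$ (j, i)) = 1"
    and "\<And>j. j < n \<Longrightarrow> ys ! j = (\<Sum>i<n. A $$ (j, i) *\<^sub>R xs ! i)"
    and "set xs \<subseteq> H" "set ys \<subseteq> H" "length xs = n" "length ys = n"
  shows "vol ys = Determinant.det A * vol xs"
proof -
  have "bary_mat ys = A * bary_mat xs"
    by (rule bary_mat_affine_map) (use assms in auto)
  then show ?thesis
    by (simp add: vol_def det_mult[OF assms(1) bary_mat_carrier])
qed

text \<open>An affine map between lists of \<open>m\<close> points extends by the identity on
  \<open>ps\<close>, and the block diagonal matrix keeps the determinant of \<open>A\<close>. Lists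
  shorter than \<open>n\<close> thereby become comparable through volumes.\<close>

lemma vol_append_affine_map:
  assumes A: "A \<in> carrier_mat m m" "\<And>j. j < m \<Longrightarrow> (\<Sum>i<m. A $$ (j, i)) = 1"
    and ys: "\<And>j. j < m \<Longrightarrow> ys ! j = (\<Sum>i<m. A $$ (j, i) *\<^sub>R xs ! i)"
    and len: "length xs = m" "length ys = m" "length ps + m = n"
    and H: "set ps \<subseteq> H" "set xs \<subseteq> H" "set ys \<subseteq> H"
  shows "vol (ps @ ys) = Determinant.det A * vol (ps @ xs)"
proof -
  define k where "k = length ps"
  define B where "B = four_block_mat (1\<^sub>m k) (0\<^sub>m k m) (0\<^sub>m m k) A"
  have km: "n = k + m"
    using len k_def by simp
  have split: "sum f {..<n} = sum f {..<k} + (\<Sum>i<m. f (k + i))" for f :: "nat \<Rightarrow> 'b::comm_monoid_add"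
    unfolding km by (induction m) (simp_all add: add.assoc)
  have entry: "B $$ (j, i) = (if j < k then if j = i then 1 else 0
      else if i < k then 0 else A $$ (j - k, i - k))" if "j < n" "i < n" for i j
    using that A(1) unfolding B_def km by (auto simp: four_block_mat_def Let_def)
  have det: "Determinant.det B = Determinant.det A"
    unfolding B_def using A(1) by (subst det_four_block_mat_upper_right_zero) auto
  have "vol (ps @ ys) = Determinant.det B * vol (ps @ xs)"
  proof (rule vol_affine_map)
    show "B \<in> carrier_mat n n"
      unfolding B_def km using A(1) by (intro four_block_carrier_mat) auto
    show "(\<Sum>i<n. B $$ (j, i)) = 1" if j: "j < n" for j
    proof (cases "j < k")
      case True
      then show ?thesis
        using j unfolding split by (simp add: entry km)
    next
      case False
      then show ?thesis
        using j A(2)[of "j - k"] unfolding split by (simp add: entry km)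
    qed
    show "(ps @ ys) ! j = (\<Sum>i<n. B $$ (j, i) *\<^sub>R (ps @ xs) ! i)" if j: "j < n" for j
    proof (cases "j < k")
      case True
      have "(\<Sum>i<k. B $$ (j, i) *\<^sub>R (ps @ xs) ! i) = (\<Sum>i<k. if j = i then ps ! j else 0)"
        using j True by (intro sum.cong) (auto simp: entry km nth_append k_def)
      moreover have "(\<Sum>i<m. B $$ (j, k + i) *\<^sub>R (ps @ xs) ! (k + i)) = 0"
        using j True by (intro sum.neutral) (auto simp: entry km)
      ultimately show ?thesis
        using j True unfolding split by (simp add: nth_append k_def)
    next
      case False
      have "(\<Sum>i<m. B $$ (j, k + i) *\<^sub>R (ps @ xs) ! (k + i)) = (\<Sum>i<m. A $$ (j - k, i) *\<^sub>R xs ! i)"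
        using j False by (intro sum.cong) (auto simp: entry km nth_append k_def)
      moreover have "(\<Sum>i<k. B $$ (j, i) *\<^sub>R (ps @ xs) ! i) = 0"
        using j False by (intro sum.neutral) (auto simp: entry km)
      ultimately show ?thesis
        using j False ys[of "j - k"] unfolding split by (simp add: nth_append k_def km)
    qed
  qed (use len H in auto)
  then show ?thesis
    by (simp add: det)
qed

lemma vol_frame: "vol X = 1"
proof -
  have "bary_mat X = 1\<^sub>m n"
  proof (rule eq_matI)
    fix i j assume "i < dim_row (1\<^sub>m n :: real Matrix.mat)" "j < dim_col (1\<^sub>m n :: real Matrix.mat)"
    then have ij: "i < n" "j < n"
      by auto
    have "bary (X ! i) j = (if i = j then 1 else 0)"
    proof (rule bary_unique)
      show "X ! i \<in> H"
        using ij by (simp add: hull_inc)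
      show "(\<Sum>j<n. if i = j then 1 else 0) = (1::real)"
        using ij by simp
      have "(\<Sum>j<n. (if i = j then 1 else 0) *\<^sub>R X ! j) = (\<Sum>j<n. if i = j then X ! i else 0)"
        by (intro sum.cong) auto
      then show "(\<Sum>j<n. (if i = j then 1 else 0) *\<^sub>R X ! j) = X ! i"
        using ij by simp
    qed (use ij in simp)
    then show "bary_mat X $$ (i, j) = 1\<^sub>m n $$ (i, j)"
      using ij by (simp add: bary_mat_def)
  qed (simp_all add: bary_mat_def)
  then show ?thesis
    by (simp add: vol_def)
qed

text \<open>The frame is an affine image of \<open>L\<close>, so \<open>1 = vol X\<close> is a
  multiple of \<open>vol L\<close>.\<close>

lemma vol_nonzero:
  assumes "distinct L" "length L = n" "set L \<subseteq> H" "set X \<subseteq> affine hull set L"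
  shows "vol L \<noteq> 0"
proof -
  obtain A where A: "A \<in> carrier_mat n n" "\<And>j. j < n \<Longrightarrow> (\<Sum>i<n. A $$ (j, i)) = 1"
    "\<And>j. j < n \<Longrightarrow> X ! j = (\<Sum>i<n. A $$ (j, i) *\<^sub>R L ! i)"
    using affine_hull_coordinate_matrix[OF assms(1,4)] assms(2) by metis
  have "vol X = Determinant.det A * vol L"
    by (rule vol_affine_map[OF A]) (use assms in \<open>auto simp: hull_inc\<close>)
  then show ?thesis
    by (auto simp: vol_frame)
qed

text \<open>Expansion along the first row: the cofactors depend only on \<open>L\<close>, and the
  entries of that row are affine in the first point.\<close>

lemma vol_Cons_affine_combination:
  assumes "\<And>l. l \<in> I \<Longrightarrow> q l \<in> H" "sum c I = 1" "p = (\<Sum>l\<in>I. c l *\<^sub>R q l)" "p \<in> H"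
    and "Suc (length L) = n"
  shows "vol (p # L) = (\<Sum>l\<in>I. c l * vol (q l # L))"
proof -
  have n: "0 < n"
    using assms(5) by linarith
  have del: "mat_delete (bary_mat (r # L)) 0 j = mat_delete (bary_mat (p # L)) 0 j" for r j
    by (rule eq_matI) (auto simp: mat_delete_def bary_mat_def)
  have entry: "bary_mat (r # L) $$ (0, j) = bary r j" if "j < n" for r j
    using that n by (simp add: bary_mat_def)
  have vol: "vol (r # L) = (\<Sum>j<n. bary r j * cofactor (bary_mat (p # L)) 0 j)" for r
    unfolding vol_def laplace_expansion_row[OF bary_mat_carrier n]
    by (intro sum.cong) (simp_all add: cofactor_def del[of r] entry)
  have "vol (p # L) = (\<Sum>j<n. (\<Sum>l\<in>I. c l * bary (q l) j) * cofactor (bary_mat (p # L)) 0 j)"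
    unfolding vol[of p] using bary_affine_combination[OF assms(1-4)] by (intro sum.cong) auto
  also have "\<dots> = (\<Sum>l\<in>I. \<Sum>j<n. c l * bary (q l) j * cofactor (bary_mat (p # L)) 0 j)"
    by (subst sum.swap) (simp add: sum_distrib_right)
  also have "\<dots> = (\<Sum>l\<in>I. c l * vol (q l # L))"
    unfolding vol by (simp add: sum_distrib_left mult.assoc)
  finally show ?thesis .
qed

lemma vol_Cons_member:
  assumes "Suc (length L) = n" "p \<in> set L"
  shows "vol (p # L) = 0"
proof -
  obtain i where i: "i < length L" "L ! i = p"
    using assms(2) by (auto simp: in_set_conv_nth)
  have n: "X \<noteq> []"
    using assms(1) by auto
  show ?thesis
    unfolding vol_def
  proof (rule det_identical_rows[OF bary_mat_carrier, of 0 "Suc i"])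
    show "Matrix.row (bary_mat (p # L)) 0 = Matrix.row (bary_mat (p # L)) (Suc i)"
      using i assms(1) n by (intro eq_vecI) (auto simp: bary_mat_def Matrix.row_def)
  qed (use i assms(1) in auto)
qed

text \<open>Expanding the two determinants along row 0 and row \<open>i\<close> gives the same
  minors; only the checkerboard signs differ. The factor is the one that appears in the boundary
  formula.\<close>

lemma vol_move_to_front:
  assumes "length L = n" "i < n"
  shows "vol (L ! i # omit_nth i L) = (- 1) ^ i * vol L"
proof -
  have n: "0 < n"
    using assms(2) by linarith
  have del: "mat_delete (bary_mat (L ! i # omit_nth i L)) 0 j = mat_delete (bary_mat L) i j" for j
    using assms by (intro eq_matI) (auto simp: mat_delete_def bary_mat_def nth_omit_nth)
  have "vol (L ! i # omit_nth i L) = (\<Sum>j<n. bary (L ! i) j * ((- 1) ^ j * Determinant.det (mat_delete (bary_mat L) i j)))"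
    unfolding vol_def laplace_expansion_row[OF bary_mat_carrier n]
    using n by (intro sum.cong) (auto simp: cofactor_def del, auto simp: bary_mat_def)
  moreover have "vol L = (\<Sum>j<n. bary (L ! i) j * ((- 1) ^ (i + j) * Determinant.det (mat_delete (bary_mat L) i j)))"
    unfolding vol_def laplace_expansion_row[OF bary_mat_carrier assms(2)]
    using assms by (intro sum.cong) (auto simp: cofactor_def, auto simp: bary_mat_def)
  ultimately show ?thesis
    by (auto simp: sum_distrib_left power_add simp flip: power_mult_distrib intro!: sum.cong)
qed

text \<open>Prepending \<^term>\<open>ps\<close> turns lower-dimensional lists into full-dimensional ones, so that the signs
  of faces become signs of volumes and can be compared across dimensions.\<close>

lemma relative_sign_eq_vol:
  assumes "distinct xs" "length xs = length ys" "length ps + length xs = n"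
    and "set ps \<subseteq> H" "set xs \<subseteq> H" "set ys \<subseteq> H" "set ys \<subseteq> affine hull set xs"
    and nz: "vol (ps @ xs) \<noteq> 0" "vol (ps @ ys) \<noteq> 0"
  shows "relative_sign xs ys = sgn (vol (ps @ xs)) * sgn (vol (ps @ ys))"
proof -
  have vol: "vol (ps @ ys) = Determinant.det A * vol (ps @ xs)"
    if "A \<in> carrier_mat (length xs) (length xs)"
      "\<And>j. j < length xs \<Longrightarrow> (\<Sum>i<length xs. A $$ (j, i)) = 1"
      "\<And>j. j < length xs \<Longrightarrow> ys ! j = (\<Sum>i<length xs. A $$ (j, i) *\<^sub>R xs ! i)" for A
    by (rule vol_append_affine_map[OF that]) (use assms in auto)
  obtain A where A: "A \<in> carrier_mat (length xs) (length xs)"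
      "\<And>j. j < length xs \<Longrightarrow> (\<Sum>i<length xs. A $$ (j, i)) = 1"
      "\<And>j. j < length xs \<Longrightarrow> ys ! j = (\<Sum>i<length xs. A $$ (j, i) *\<^sub>R xs ! i)"
    using affine_hull_coordinate_matrix[OF assms(1,7)] assms(2) by metis
  \<comment> \<open>By \<open>vol\<close>, every admissible matrix has the same determinant, the
    quotient of the two volumes; the existential in \<open>compatibly_oriented\<close> can thus be
    decided on the one matrix \<open>A\<close>.\<close>
  have "compatibly_oriented xs ys \<longleftrightarrow> 0 < Determinant.det A"
  proof
    assume "compatibly_oriented xs ys"
    then obtain B where "B \<in> carrier_mat (length xs) (length xs)"
      "\<And>j. j < length xs \<Longrightarrow> (\<Sum>i<length xs. B $$ (j, i)) = 1"
      "\<And>j. j < length xs \<Longrightarrow> ys ! j = (\<Sum>i<length xs. B $$ (j, i) *\<^sub>R xs ! i)"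
      and B: "0 < Determinant.det B"
      by (auto simp: compatibly_oriented_def)
    then have "vol (ps @ ys) = Determinant.det B * vol (ps @ xs)"
      by (intro vol)
    with vol[OF A] nz B show "0 < Determinant.det A"
      by simp
  qed (use A assms(2) in \<open>auto simp: compatibly_oriented_def\<close>)
  then show ?thesis
    using vol[OF A] nz by (auto simp: relative_sign_def sgn_mult sgn_if zero_less_mult_iff)
qed

lemma relative_sign_eq_vol_Cons:
  assumes "distinct xs" "length xs = length ys" "Suc (length xs) = n"
    and "p \<in> H" "set xs \<subseteq> H" "set ys \<subseteq> H" "set ys \<subseteq> affine hull set xs"
    and "vol (p # xs) \<noteq> 0" "vol (p # ys) \<noteq> 0"
  shows "relative_sign xs ys = sgn (vol (p # xs)) * sgn (vol (p # ys))"
  using relative_sign_eq_vol[of xs ys "[p]"] assms by simp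

text \<open>Moving the deleted vertex \<open>u\<close> to the front of \<open>ori S\<close> costs
  \<open>(- 1) ^ i\<close>, which cancels the sign of the boundary formula. What remains is a factor
  for \<open>S\<close> times a factor for the facet together with its opposite vertex.\<close>

lemma incidence_number_eq_vol:
  assumes L: "distinct (ori S)" "set (ori S) \<subseteq> H" "set X \<subseteq> affine hull set (ori S)" "length (ori S) = n"
    and u: "u \<in> set (ori S)"
    and T: "simplex_vertices T = set (ori S) - {u}" "distinct (ori T)" "set (ori T) = set (ori S) - {u}"
  shows "incidence_number ori S T = sgn (vol (ori S)) * sgn (vol (u # ori T))"
    and "vol (u # ori T) \<noteq> 0"
proof -
  have set: "set (u # ori T) = set (ori S)"
    using T u by auto
  have dist: "distinct (u # ori T)"
    using T by auto
  then have len: "length (u # ori T) = n"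
    using set L by (metis distinct_card)
  show nz: "vol (u # ori T) \<noteq> 0"
    by (rule vol_nonzero[OF dist len]) (use set L in simp_all)
  obtain i where i: "i < n" "ori S ! i = u"
    using u L by (auto simp: in_set_conv_nth)
  \<comment> \<open>Deleting different entries leaves different vertex sets, so a single summand of
    the incidence number survives.\<close>
  have om: "set (omit_nth j (ori S)) = simplex_vertices T \<longleftrightarrow> j = i" if "j < n" for j
  proof
    assume "set (omit_nth j (ori S)) = simplex_vertices T"
    then have "set (ori S) - {ori S ! j} = set (ori S) - {u}"
      using T that L by (simp add: set_omit_nth)
    then have "ori S ! j = u"
      using u that L by (metis Diff_iff insertCI insertE nth_mem singletonD)
    then show "j = i"
      using i that L by (metis nth_eq_iff_index_eq)
  qed (use T that i L in \<open>simp add: set_omit_nth\<close>)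
  have move: "vol (u # omit_nth i (ori S)) = (- 1) ^ i * vol (ori S)"
    using vol_move_to_front[of "ori S" i] i L by simp
  have sgn: "sgn ((- 1) ^ i * r) = (- 1) ^ i * sgn r" for r :: real
    by (simp add: sgn_mult power_sgn)
  have volS: "vol (ori S) \<noteq> 0"
    by (rule vol_nonzero) (use L in auto)
  have set_om: "set (omit_nth i (ori S)) = set (ori T)"
    using i L T by (simp add: set_omit_nth)
  have rs: "relative_sign (omit_nth i (ori S)) (ori T) =
      sgn (vol (u # omit_nth i (ori S))) * sgn (vol (u # ori T))"
  proof (rule relative_sign_eq_vol_Cons)
    show "vol (u # omit_nth i (ori S)) \<noteq> 0"
      using move volS by simp
    show "length (omit_nth i (ori S)) = length (ori T)" "Suc (length (omit_nth i (ori S))) = n"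
      using len i L by (auto simp: length_omit_nth)
    show "set (ori T) \<subseteq> affine hull set (omit_nth i (ori S))"
      unfolding set_om by (simp add: hull_subset)
    show "distinct (omit_nth i (ori S))"
      using L(1) by (rule distinct_omit_nth)
    show "u \<in> H"
      using L(2) u by blast
    show "set (ori T) \<subseteq> H"
      using L(2) T(3) by blast
    then show "set (omit_nth i (ori S)) \<subseteq> H"
      by (simp only: set_om)
  qed (rule nz)
  have "incidence_number ori S T =
      (\<Sum>j<n. if j = i then (- 1) ^ i * relative_sign (omit_nth i (ori S)) (ori T) else 0)"
    unfolding incidence_number_def L(4)
  proof (intro sum.cong refl)
    fix j assume "j \<in> {..<n}"
    then have "set (omit_nth j (ori S)) = simplex_vertices T \<longleftrightarrow> j = i"
      by (intro om) simp
    then show "(if set (omit_nth j (ori S)) = simplex_vertices T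
        then (- 1) ^ j * relative_sign (omit_nth j (ori S)) (ori T) else 0) =
      (if j = i then (- 1) ^ i * relative_sign (omit_nth i (ori S)) (ori T) else 0)"
      by simp
  qed
  also have "\<dots> = sgn (vol (ori S)) * sgn (vol (u # ori T))"
    using i unfolding rs move sgn by (cases "even i") simp_all
  finally show "incidence_number ori S T = sgn (vol (ori S)) * sgn (vol (u # ori T))" .
qed

end

lemma incidence_number_eq_0:
  assumes "distinct (ori S)" "\<And>u. u \<in> set (ori S) \<Longrightarrow> simplex_vertices T \<noteq> set (ori S) - {u}"
  shows "incidence_number ori S T = 0"
  unfolding incidence_number_def
proof (intro sum.neutral ballI)
  fix i assume "i \<in> {..<length (ori S)}"
  then have "set (omit_nth i (ori S)) \<noteq> simplex_vertices T"
    using assms(2)[of "ori S ! i"] by (simp add: set_omit_nth[OF assms(1)])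
  then show "(if set (omit_nth i (ori S)) = simplex_vertices T
      then (- 1) ^ i * relative_sign (omit_nth i (ori S)) (ori T) else 0) = 0"
    by simp
qed

section \<open>The subdivided simplex\<close>

lemma simplex_vertices_convex_hull:
  "\<not> affine_dependent W \<Longrightarrow> simplex_vertices (convex hull W) = W"
  by (simp add: simplex_vertices_def extreme_point_of_convex_hull_affine_independent)

lemma simplex_convex_hull_iff:
  assumes "\<not> affine_dependent W"
  shows "int p simplex (convex hull W) \<longleftrightarrow> card W = Suc p"
proof
  assume "int p simplex (convex hull W)"
  then obtain W' where W': "\<not> affine_dependent W'" "int (card W') = int p + 1" "convex hull W = convex hull W'"
    by (auto simp: simplex_def)
  then have "W = W'"
    using assms simplex_vertices_convex_hull by metis
  then show "card W = Suc p"
    using W' by simp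
qed (use assms in \<open>auto simp: simplex_def\<close>)

text \<open>The simplex has dimension \<open>d = Suc e\<close> and vertex set \<^term>\<open>set X\<close>; it is subdivided along the face
  with vertex set \<^term>\<open>A\<close>, and \<^term>\<open>t\<close> gives the barycentric coordinates of the new vertex \<^term>\<open>v\<close>.\<close>

locale stellar_simplex = barycentric_frame X for X :: "'a::euclidean_space list" +
  fixes A :: "'a set" and t :: "'a \<Rightarrow> real" and v :: 'a and e :: nat
    and N M :: "'a set set" and oriN oriM :: "'a set \<Rightarrow> 'a list"
  assumes A_subset: "A \<subseteq> set X" and two_le_card_A: "2 \<le> card A"
    and t_pos: "\<And>b. b \<in> A \<Longrightarrow> 0 < t b" and sum_t: "sum t A = 1"
    and v_eq: "v = (\<Sum>b\<in>A. t b *\<^sub>R b)"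
    and length_X: "length X = Suc (Suc e)"
    and N_eq: "N = {convex hull W | W. W \<subseteq> set X}"
    and M_eq: "M = {convex hull W | W. \<exists>a\<in>A. W \<subseteq> insert v (set X - {a})}"
    and oriN: "complex_orientation N oriN" and oriM: "complex_orientation M oriM"
begin

abbreviation C :: "'a set" where "C \<equiv> set X"

text \<open>A set of vertices: those of the top cell in which \<open>v\<close> takes the place of
  \<open>a\<close>.\<close>

definition star :: "'a \<Rightarrow> 'a set" where "star a = insert v (C - {a})"

definition cell :: "'a \<Rightarrow> 'a set" where "cell a = convex hull star a"

text \<open>A facet is named by a cell and the vertex opposite to it; a facet shared by two cells
  therefore has two names, \<open>facet a c\<close> and \<open>facet c a\<close>.\<close>

definition facet :: "'a \<Rightarrow> 'a \<Rightarrow> 'a set" where "facet a u = convex hull (star a - {u})"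

definition base_facet :: "'a \<Rightarrow> 'a set" where "base_facet c = convex hull (C - {c})"

lemma finite_A: "finite A"
  using A_subset finite_subset by blast

lemma card_C: "card C = Suc (Suc e)"
  using distinct_frame length_X by (simp add: distinct_card)

section \<open>Affine position of the new vertex\<close>

lemma v_in_convex_hull: "A \<subseteq> W \<Longrightarrow> v \<in> convex hull W"
proof -
  have "v \<in> convex hull A"
    using t_pos sum_t v_eq finite_A by (auto simp: convex_hull_finite intro: less_imp_le)
  then show "A \<subseteq> W \<Longrightarrow> v \<in> convex hull W"
    using hull_mono by blast
qed

lemma v_in_H: "v \<in> H"
  using v_in_convex_hull[OF A_subset] convex_hull_subset_affine_hull by blast

text \<open>Since \<open>t a\<close> is positive, the equation expressing \<open>v\<close> through
  \<open>A\<close> can be solved for \<open>a\<close>.\<close>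

lemma frame_subset_affine_hull_star:
  assumes a: "a \<in> A"
  shows "C \<subseteq> affine hull star a"
proof -
  \<comment> \<open>The coefficients of that solution. The two cases are added rather than nested,
    so that the definition stays correct should \<open>v\<close> be a point of
    \<open>A - {a}\<close>, which is excluded only afterwards.\<close>
  define g where "g y = (if y = v then 1 / t a else 0) + (if y \<in> A - {a} then - t y / t a else 0)" for y
  have fin: "finite (star a)"
    by (simp add: star_def)
  have sub: "A - {a} \<subseteq> star a"
    using A_subset by (auto simp: star_def)
  have t_a: "t a > 0" "sum t (A - {a}) = 1 - t a"
    using a t_pos sum_t finite_A by (auto simp: sum_diff1)
  have "sum g (star a) = 1 / t a + (\<Sum>y\<in>A - {a}. - t y / t a)"
    unfolding g_def sum.distrib
    using fin sub sum.inter_restrict[OF fin, of "\<lambda>y. - t y / t a" "A - {a}"]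
    by (simp add: Int_absorb1 star_def)
  also have "\<dots> = 1"
    using t_a by (simp add: sum_divide_distrib[symmetric] sum_negf field_simps)
  finally have g1: "sum g (star a) = 1" .
  have "v = t a *\<^sub>R a + (\<Sum>b\<in>A - {a}. t b *\<^sub>R b)"
    unfolding v_eq using a finite_A by (simp add: sum.remove)
  then have rest: "(\<Sum>b\<in>A - {a}. t b *\<^sub>R b) = v - t a *\<^sub>R a"
    by simp
  have "(\<Sum>y\<in>star a. g y *\<^sub>R y) =
      (\<Sum>y\<in>star a. if y = v then (1 / t a) *\<^sub>R v else 0) + (\<Sum>y\<in>star a. if y \<in> A - {a} then (- t y / t a) *\<^sub>R y else 0)"
    unfolding sum.distrib[symmetric] by (intro sum.cong) (auto simp: g_def scaleR_left_distrib)
  also have "(\<Sum>y\<in>star a. if y = v then (1 / t a) *\<^sub>R v else 0) = (1 / t a) *\<^sub>R v"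
    using fin by (simp add: star_def)
  also have "(\<Sum>y\<in>star a. if y \<in> A - {a} then (- t y / t a) *\<^sub>R y else 0) = (\<Sum>y\<in>A - {a}. (- t y / t a) *\<^sub>R y)"
    using sub sum.inter_restrict[OF fin, of "\<lambda>y. (- t y / t a) *\<^sub>R y" "A - {a}"]
    by (simp add: Int_absorb1)
  also have "\<dots> = (- 1 / t a) *\<^sub>R (\<Sum>b\<in>A - {a}. t b *\<^sub>R b)"
    by (simp add: scaleR_sum_right)
  also have "(1 / t a) *\<^sub>R v + \<dots> = a"
    unfolding rest using t_a by (simp add: scaleR_diff_right)
  finally have "a \<in> affine hull star a"
    using g1 by (auto simp: affine_hull_finite[OF fin])
  moreover have "C - {a} \<subseteq> affine hull star a"
    using hull_subset[of "star a" affine] by (auto simp: star_def)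
  ultimately show ?thesis
    by blast
qed

text \<open>If \<open>v\<close> were redundant in \<open>star a\<close>, the points
  \<open>C - {a}\<close> would already span \<open>a\<close>, against the independence of the
  frame.\<close>

lemma v_notin_affine_hull:
  assumes a: "a \<in> A"
  shows "v \<notin> affine hull (C - {a})"
proof
  assume "v \<in> affine hull (C - {a})"
  then have "affine hull star a = affine hull (C - {a})"
    unfolding star_def by (rule hull_redundant)
  then have "a \<in> affine hull (C - {a})"
    using frame_subset_affine_hull_star[OF a] a A_subset by blast
  then show False
    using independent_frame a A_subset unfolding affine_dependent_def by blast
qed

lemma v_notin_C: "v \<notin> C"
proof
  assume "v \<in> C"
  \<comment> \<open>Uses that the subdivided face has at least two vertices: one of them differs
    from \<open>v\<close>, and \<open>v\<close> would lie among the remaining points of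
    \<open>C\<close>.\<close>
  have "\<not> A \<subseteq> {v}"
    using two_le_card_A card_mono[of "{v}" A] by auto
  then obtain a where "a \<in> A" "a \<noteq> v"
    by blast
  then show False
    using \<open>v \<in> C\<close> v_notin_affine_hull[of a] by (auto simp: hull_inc)
qed

lemma star_subset_H: "star a \<subseteq> H"
  using v_in_H by (auto simp: star_def hull_inc)

lemma finite_star: "finite (star a)"
  by (simp add: star_def)

lemma card_star: "a \<in> A \<Longrightarrow> card (star a) = Suc (Suc e)"
  using v_notin_C card_C A_subset by (auto simp: star_def)

lemma affine_hull_star: "a \<in> A \<Longrightarrow> affine hull star a = H"
  using frame_subset_affine_hull_star star_subset_H by (metis hull_minimal affine_affine_hull subset_antisym)

text \<open>Dimension count: \<open>star a\<close> has as many points as \<open>C\<close> and the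
  same affine hull.\<close>

lemma independent_star: "a \<in> A \<Longrightarrow> \<not> affine_dependent (star a)"
  using independent_frame affine_hull_star card_star card_C finite_star
  unfolding affine_independent_iff_card by (metis aff_dim_affine_hull)

lemma independent_subset_star: "a \<in> A \<Longrightarrow> W \<subseteq> star a \<Longrightarrow> \<not> affine_dependent W"
  using independent_star affine_independent_subset by blast

lemma independent_subset_C: "W \<subseteq> C \<Longrightarrow> \<not> affine_dependent W"
  using independent_frame affine_independent_subset by blast

section \<open>The simplices of \<open>N\<close> and \<open>M\<close> and their chosen
  orderings\<close>

lemma simplices_N: "simplices N p = (\<lambda>W. convex hull W) ` {W. W \<subseteq> C \<and> card W = Suc p}"
  unfolding simplices_def N_eq by (auto simp: simplex_convex_hull_iff[OF independent_subset_C])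

lemma simplices_M: "simplices M p = {convex hull W | W. (\<exists>a\<in>A. W \<subseteq> star a) \<and> card W = Suc p}"
  unfolding simplices_def M_eq star_def[symmetric]
  by (auto simp: simplex_convex_hull_iff[OF independent_subset_star]) blast

lemma finite_simplices_M: "finite (simplices M p)"
proof (rule finite_subset)
  show "simplices M p \<subseteq> (\<lambda>W. convex hull W) ` Pow (insert v C)"
    by (auto simp: simplices_M star_def)
qed simp

lemma oriN_props:
  assumes "W \<subseteq> C" "card W = Suc p"
  shows "distinct (oriN (convex hull W))" "set (oriN (convex hull W)) = W"
proof -
  have "convex hull W \<in> simplices N p"
    unfolding simplices_N using assms by blast
  then have "distinct (oriN (convex hull W)) \<and>
      set (oriN (convex hull W)) = simplex_vertices (convex hull W)"
    using oriN unfolding complex_orientation_def by blast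
  then show "distinct (oriN (convex hull W))" "set (oriN (convex hull W)) = W"
    by (simp_all add: simplex_vertices_convex_hull independent_subset_C[OF assms(1)])
qed

lemma oriM_props:
  assumes "a \<in> A" "W \<subseteq> star a" "card W = Suc p"
  shows "distinct (oriM (convex hull W))" "set (oriM (convex hull W)) = W"
proof -
  have "convex hull W \<in> simplices M p"
    unfolding simplices_M using assms by blast
  then have "distinct (oriM (convex hull W)) \<and>
      set (oriM (convex hull W)) = simplex_vertices (convex hull W)"
    using oriM unfolding complex_orientation_def by blast
  then show "distinct (oriM (convex hull W))" "set (oriM (convex hull W)) = W"
    by (simp_all add: simplex_vertices_convex_hull independent_subset_star[OF assms(1,2)])
qed

lemma a_notin_star: "a \<in> A \<Longrightarrow> a \<notin> star a"
  using v_notin_C A_subset by (auto simp: star_def)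

lemma star_eq_iff: "a \<in> A \<Longrightarrow> b \<in> A \<Longrightarrow> star a = star b \<longleftrightarrow> a = b"
  using v_notin_C A_subset by (auto simp: star_def)

lemma convex_hull_eq_iff:
  "a \<in> A \<Longrightarrow> b \<in> A \<Longrightarrow> W \<subseteq> star a \<Longrightarrow> W' \<subseteq> star b \<Longrightarrow> convex hull W = convex hull W' \<longleftrightarrow> W = W'"
  using independent_subset_star simplex_vertices_convex_hull by metis

lemma inj_cell: "inj_on cell A"
  by (rule inj_onI) (simp add: cell_def convex_hull_eq_iff star_eq_iff)

lemma inj_facet: "a \<in> A \<Longrightarrow> inj_on (facet a) (star a)"
proof (rule inj_onI)
  fix u w assume "a \<in> A" "u \<in> star a" "w \<in> star a" "facet a u = facet a w"
  then have "star a - {u} = star a - {w}"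
    unfolding facet_def using convex_hull_eq_iff[of a a] by (metis Diff_subset)
  then show "u = w"
    using \<open>u \<in> star a\<close> by blast
qed

lemma simplices_M_top: "simplices M (Suc e) = cell ` A"
proof -
  have "W = star a" if "a \<in> A" "W \<subseteq> star a" "card W = Suc (Suc e)" for a W
    using that card_star finite_star by (simp add: card_subset_eq)
  then show ?thesis
    unfolding simplices_M cell_def image_def using card_star by blast
qed

lemma card_facet: "a \<in> A \<Longrightarrow> u \<in> star a \<Longrightarrow> card (star a - {u}) = Suc e"
  using card_star by simp

lemma facet_in_simplices: "a \<in> A \<Longrightarrow> u \<in> star a \<Longrightarrow> facet a u \<in> simplices M e"
  unfolding simplices_M facet_def using card_facet by blast

lemma facet_v: "a \<in> A \<Longrightarrow> facet a v = base_facet a"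
  using v_notin_C by (simp add: facet_def base_facet_def star_def)

lemma facet_swap: "facet a c = facet c a" if "a \<in> A" "c \<in> A"
proof -
  have "star a - {c} = star c - {a}"
    using that v_notin_C A_subset by (auto simp: star_def)
  then show ?thesis
    by (simp add: facet_def)
qed

section \<open>Signs of cells and facets relative to the frame\<close>

definition cell_sign :: "'a \<Rightarrow> real" where "cell_sign a = sgn (vol (oriM (cell a)))"

text \<open>Compares the ordering of the facet, preceded by its opposite vertex, with the frame;
  replacing \<open>u\<close> by a point on the other side of the facet would flip the sign.\<close>

definition facet_sign :: "'a \<Rightarrow> 'a \<Rightarrow> real" where "facet_sign a u = sgn (vol (u # oriM (facet a u)))"

lemma oriM_cell:
  assumes "a \<in> A"
  shows "distinct (oriM (cell a))" "set (oriM (cell a)) = star a" "length (oriM (cell a)) = n"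
proof -
  show 1: "distinct (oriM (cell a))" "set (oriM (cell a)) = star a"
    unfolding cell_def using oriM_props[OF assms subset_refl card_star[OF assms]] by auto
  then show "length (oriM (cell a)) = n"
    using card_star[OF assms] length_X by (metis distinct_card)
qed

lemma oriM_facet:
  assumes "a \<in> A" "u \<in> star a"
  shows "distinct (oriM (facet a u))" "set (oriM (facet a u)) = star a - {u}"
    "length (oriM (facet a u)) = Suc e"
proof -
  show 1: "distinct (oriM (facet a u))" "set (oriM (facet a u)) = star a - {u}"
    unfolding facet_def using oriM_props[OF assms(1) _ card_facet[OF assms]] by auto
  then show "length (oriM (facet a u)) = Suc e"
    using card_facet[OF assms] by (metis distinct_card)
qed

lemma oriN_base_facet:
  assumes "c \<in> C"
  shows "distinct (oriN (base_facet c))" "set (oriN (base_facet c)) = C - {c}"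
    "length (oriN (base_facet c)) = Suc e"
proof -
  have "card (C - {c}) = Suc e"
    using assms card_C by simp
  then show 1: "distinct (oriN (base_facet c))" "set (oriN (base_facet c)) = C - {c}"
    unfolding base_facet_def using oriN_props by auto
  then show "length (oriN (base_facet c)) = Suc e"
    using \<open>card (C - {c}) = Suc e\<close> by (metis distinct_card)
qed

lemma vol_oriM_cell: "a \<in> A \<Longrightarrow> vol (oriM (cell a)) \<noteq> 0"
  using oriM_cell star_subset_H frame_subset_affine_hull_star by (intro vol_nonzero) auto

lemma incidence_facet:
  assumes "a \<in> A" "u \<in> star a"
  shows "incidence_number oriM (cell a) (facet a u) = cell_sign a * facet_sign a u"
    and "vol (u # oriM (facet a u)) \<noteq> 0"
proof -
  have vert: "simplex_vertices (facet a u) = star a - {u}"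
    unfolding facet_def
    by (rule simplex_vertices_convex_hull) (use independent_subset_star[OF assms(1)] in blast)
  note [simp] = oriM_cell[OF assms(1)] oriM_facet[OF assms] vert
  note inc = incidence_number_eq_vol[of oriM "cell a" u "facet a u"]
  show "incidence_number oriM (cell a) (facet a u) = cell_sign a * facet_sign a u"
    unfolding cell_sign_def facet_sign_def
    by (rule inc(1)) (use assms star_subset_H frame_subset_affine_hull_star in simp_all)
  show "vol (u # oriM (facet a u)) \<noteq> 0"
    by (rule inc(2)) (use assms star_subset_H frame_subset_affine_hull_star in simp_all)
qed

lemma incidence_not_facet:
  assumes "a \<in> A" "T \<in> simplices M e" "T \<notin> facet a ` star a"
  shows "incidence_number oriM (cell a) T = 0"
proof (rule incidence_number_eq_0)
  obtain b W where W: "b \<in> A" "W \<subseteq> star b" "T = convex hull W"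
    using assms(2) by (auto simp: simplices_M)
  then have vert: "simplex_vertices T = W"
    using independent_subset_star simplex_vertices_convex_hull by blast
  fix u assume "u \<in> set (oriM (cell a))"
  then show "simplex_vertices T \<noteq> set (oriM (cell a)) - {u}"
    using vert W assms oriM_cell by (auto simp: facet_def)
qed (use oriM_cell assms in blast)

lemma sgn_mult_self: "x \<noteq> 0 \<Longrightarrow> sgn x * sgn x = 1" for x :: real
  by (simp add: sgn_if)

lemma cell_sign_square: "a \<in> A \<Longrightarrow> cell_sign a * cell_sign a = 1"
  unfolding cell_sign_def using vol_oriM_cell by (rule sgn_mult_self)

lemma facet_sign_square: "a \<in> A \<Longrightarrow> u \<in> star a \<Longrightarrow> facet_sign a u * facet_sign a u = 1"
  unfolding facet_sign_def using incidence_facet(2) by (rule sgn_mult_self)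

text \<open>Since \<^term>\<open>v\<close> is a vertex of the common facet, \<open>0 = vol (v # L) = t a * vol (a # L) + t c * vol (c # L)\<close>:
  the two cells lie on opposite sides of it.\<close>

lemma facet_sign_swap:
  assumes a: "a \<in> A" and c: "c \<in> A" and "a \<noteq> c"
  shows "facet_sign c a = - facet_sign a c"
proof -
  define L where "L = oriM (facet a c)"
  have c_star: "c \<in> star a"
    using assms A_subset by (auto simp: star_def)
  note L = oriM_facet[OF a c_star, folded L_def]
  have len: "Suc (length L) = n"
    using L length_X by simp
  have "c \<noteq> v"
    using v_notin_C c A_subset by blast
  then have "vol (v # L) = 0"
    by (intro vol_Cons_member[OF len]) (auto simp: L star_def)
  moreover have "vol (v # L) = (\<Sum>b\<in>A. t b * vol (b # L))"
    by (rule vol_Cons_affine_combination[where q = "\<lambda>b. b"])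
      (use A_subset sum_t v_eq v_in_H len in \<open>auto simp: hull_inc\<close>)
  moreover have "(\<Sum>b\<in>A. t b * vol (b # L)) = (\<Sum>b\<in>{a, c}. t b * vol (b # L))"
  proof (rule sum.mono_neutral_right[OF finite_A])
    \<comment> \<open>Every other point of \<open>A\<close> is a vertex of the common facet, so its
      matrix has two equal rows.\<close>
    show "\<forall>b\<in>A - {a, c}. t b * vol (b # L) = 0"
      using A_subset by (auto simp: L star_def intro!: vol_Cons_member[OF len])
  qed (use a c in auto)
  ultimately have "t a * vol (a # L) = - (t c * vol (c # L))"
    using assms(3) by simp
  then have "sgn (t a) * sgn (vol (a # L)) = - (sgn (t c) * sgn (vol (c # L)))"
    by (metis sgn_mult sgn_minus)
  then have "sgn (vol (a # L)) = - sgn (vol (c # L))"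
    using t_pos a c by simp
  then show ?thesis
    unfolding facet_sign_def facet_swap[OF c a] L_def .
qed

section \<open>Boundaries of chains in the complement\<close>

lemma chain_bd_eq:
  assumes "T \<in> simplices M e"
  shows "chain_bd oriM M e y T = (\<Sum>a\<in>A. y (cell a) * incidence_number oriM (cell a) T)"
  using assms by (simp add: chain_bd_def simplices_M_top sum.reindex[OF inj_cell])

text \<open>The adjoint of the boundary operator: the inner sum is the coefficient at
  \<open>cell a\<close> of the coboundary of \<open>x\<close>, with one term for each facet of the
  cell.\<close>

lemma chain_inner_bd:
  "chain_inner M e x (chain_bd oriM M e y) =
     (\<Sum>a\<in>A. y (cell a) * (\<Sum>u\<in>star a. x (facet a u) * (cell_sign a * facet_sign a u)))"
proof -
  have "chain_inner M e x (chain_bd oriM M e y) =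
      (\<Sum>T\<in>simplices M e. \<Sum>a\<in>A. y (cell a) * (x T * incidence_number oriM (cell a) T))"
    unfolding chain_inner_def
    by (intro sum.cong refl) (simp add: chain_bd_eq sum_distrib_left mult.left_commute)
  also have "\<dots> = (\<Sum>a\<in>A. y (cell a) * (\<Sum>T\<in>simplices M e. x T * incidence_number oriM (cell a) T))"
    by (subst sum.swap) (simp add: sum_distrib_left)
  also have "\<dots> = (\<Sum>a\<in>A. y (cell a) * (\<Sum>u\<in>star a. x (facet a u) * (cell_sign a * facet_sign a u)))"
  proof (rule sum.cong[OF refl])
    fix a assume a: "a \<in> A"
    have "(\<Sum>T\<in>simplices M e. x T * incidence_number oriM (cell a) T) =
        (\<Sum>T\<in>facet a ` star a. x T * incidence_number oriM (cell a) T)"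
      using a facet_in_simplices incidence_not_facet
      by (intro sum.mono_neutral_right finite_simplices_M) auto
    also have "\<dots> = (\<Sum>u\<in>star a. x (facet a u) * (cell_sign a * facet_sign a u))"
      using a by (simp add: sum.reindex[OF inj_facet] incidence_facet)
    finally show "y (cell a) * (\<Sum>T\<in>simplices M e. x T * incidence_number oriM (cell a) T) =
        y (cell a) * (\<Sum>u\<in>star a. x (facet a u) * (cell_sign a * facet_sign a u))"
      by simp
  qed
  finally show ?thesis .
qed

text \<open>A point \<open>b\<close> of \<open>A\<close> other than \<open>a\<close> and
  \<open>u\<close> is a vertex of \<open>facet a u\<close> but not of \<open>cell b\<close>. Hence
  only \<open>cell a\<close> and, if \<open>u\<close> is in \<open>A\<close>, \<open>cell u\<close>
  have this facet.\<close>

lemma incidence_facet_cases: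
  assumes a: "a \<in> A" and u: "u \<in> star a" and b: "b \<in> A"
  shows "incidence_number oriM (cell b) (facet a u) =
    (if b = a then cell_sign a * facet_sign a u else if b = u then cell_sign u * facet_sign u a else 0)"
proof -
  consider "b = a" | "b \<noteq> a" "b = u" | "b \<noteq> a" "b \<noteq> u"
    by blast
  then show ?thesis
  proof cases
    case 1
    then show ?thesis
      using a u by (simp add: incidence_facet)
  next
    case 2
    then have "a \<in> star u"
      using a A_subset by (auto simp: star_def)
    then show ?thesis
      using 2 a b facet_swap[of a u] by (simp add: incidence_facet)
  next
    case 3
    have "facet a u \<noteq> facet b w" for w
    proof
      assume "facet a u = facet b w"
      then have "star a - {u} = star b - {w}"
        unfolding facet_def using convex_hull_eq_iff[OF a b] by (metis Diff_subset)
      moreover have "b \<in> star a - {u}"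
        using 3 b A_subset by (auto simp: star_def)
      ultimately show False
        using a_notin_star[OF b] by blast
    qed
    then have "incidence_number oriM (cell b) (facet a u) = 0"
      using a u b facet_in_simplices by (intro incidence_not_facet) auto
    then show ?thesis
      using 3 by simp
  qed
qed

text \<open>The second term belongs to facets shared by two cells; for \<open>u = v\<close> or
  \<open>u\<close> in \<open>C - A\<close> the facet lies in the boundary of the simplex.\<close>

lemma chain_bd_facet:
  assumes a: "a \<in> A" and u: "u \<in> star a"
  shows "chain_bd oriM M e y (facet a u) =
    y (cell a) * cell_sign a * facet_sign a u + (if u \<in> A then y (cell u) * cell_sign u * facet_sign u a else 0)"
proof -
  have "u \<noteq> a"
    using u a_notin_star[OF a] by blast
  have "chain_bd oriM M e y (facet a u) =
      (\<Sum>b\<in>A. y (cell b) * incidence_number oriM (cell b) (facet a u))"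
    using assms facet_in_simplices by (intro chain_bd_eq) auto
  also have "\<dots> = (\<Sum>b\<in>A. (if b = a then y (cell a) * cell_sign a * facet_sign a u else 0)
      + (if b = u then y (cell u) * cell_sign u * facet_sign u a else 0))"
    using assms \<open>u \<noteq> a\<close> by (intro sum.cong) (auto simp: incidence_facet_cases)
  also have "\<dots> = y (cell a) * cell_sign a * facet_sign a u + (if u \<in> A then y (cell u) * cell_sign u * facet_sign u a else 0)"
    using a finite_A by (simp add: sum.distrib)
  finally show ?thesis .
qed

text \<open>Chains in the complement are eigenvectors of the boundary followed by its adjoint; the
  hypothesis is membership in the complement, in coordinates.\<close>

lemma chain_inner_bd_bd:
  assumes y: "(\<Sum>a\<in>A. y (cell a) * cell_sign a) = 0"
  shows "chain_inner M e (chain_bd oriM M e y) (chain_bd oriM M e y) =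
    (real (Suc e) + 2) * (\<Sum>a\<in>A. (y (cell a))\<^sup>2)"
proof -
  have inner: "(\<Sum>u\<in>star a. chain_bd oriM M e y (facet a u) * (cell_sign a * facet_sign a u)) =
      (real (Suc e) + 2) * y (cell a)" if a: "a \<in> A" for a
  proof -
    \<comment> \<open>In the diagonal term all signs square to 1; in the term of the neighbouring
      cell \<open>u\<close>, \<open>facet_sign_swap\<close> leaves a minus sign.\<close>
    have "chain_bd oriM M e y (facet a u) * (cell_sign a * facet_sign a u) =
        y (cell a) + (if u \<in> A - {a} then - cell_sign a * (y (cell u) * cell_sign u) else 0)"
      if u: "u \<in> star a" for u
    proof -
      have sq: "cell_sign a * (cell_sign a * r) = r" "facet_sign a u * (facet_sign a u * r) = r" for r
        using cell_sign_square[OF a] facet_sign_square[OF a u] by (simp_all flip: mult.assoc)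
      have "u \<noteq> a"
        using u a_notin_star[OF a] by blast
      then show ?thesis
        using facet_sign_swap[OF a] facet_sign_square[OF a u] cell_sign_square[OF a]
        by (auto simp: chain_bd_facet[OF a u] algebra_simps sq)
    qed
    then have "(\<Sum>u\<in>star a. chain_bd oriM M e y (facet a u) * (cell_sign a * facet_sign a u)) =
        real (card (star a)) * y (cell a) + (\<Sum>u\<in>star a. if u \<in> A - {a} then - cell_sign a * (y (cell u) * cell_sign u) else 0)"
      by (simp add: sum.distrib)
    also have "(\<Sum>u\<in>star a. if u \<in> A - {a} then - cell_sign a * (y (cell u) * cell_sign u) else 0) =
        (\<Sum>u\<in>star a \<inter> (A - {a}). - cell_sign a * (y (cell u) * cell_sign u))"
      by (rule sum.inter_restrict[OF finite_star, symmetric])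
    also have "star a \<inter> (A - {a}) = A - {a}"
      using A_subset by (auto simp: star_def)
    also have "(\<Sum>u\<in>A - {a}. - cell_sign a * (y (cell u) * cell_sign u)) = - cell_sign a * (\<Sum>u\<in>A - {a}. y (cell u) * cell_sign u)"
      by (simp only: sum_distrib_left)
    \<comment> \<open>The vanishing of the full sum turns the neighbours into one more copy of
      \<open>y (cell a)\<close>, on top of the \<open>card (star a) = Suc (Suc e)\<close> copies
      from the facets; together these are \<open>Suc e + 2\<close>.\<close>
    also have "(\<Sum>u\<in>A - {a}. y (cell u) * cell_sign u) = - (y (cell a) * cell_sign a)"
      using y sum.remove[OF finite_A a, of "\<lambda>u. y (cell u) * cell_sign u"] by simp
    also have "- cell_sign a * - (y (cell a) * cell_sign a) = y (cell a)"
      using cell_sign_square[OF a] by (simp add: mult.left_commute)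
    finally show ?thesis
      using card_star[OF a] by (simp add: algebra_simps)
  qed
  have "chain_inner M e (chain_bd oriM M e y) (chain_bd oriM M e y) =
      (\<Sum>a\<in>A. y (cell a) * ((real (Suc e) + 2) * y (cell a)))"
    unfolding chain_inner_bd by (intro sum.cong refl) (simp only: inner)
  also have "\<dots> = (\<Sum>a\<in>A. (real (Suc e) + 2) * (y (cell a))\<^sup>2)"
    by (simp only: power2_eq_square mult.left_commute)
  finally show ?thesis
    by (simp only: sum_distrib_left)
qed

section \<open>Faces of the simplex and the subdivision chain map\<close>

lemma convex_hull_star_subset: "convex hull star a \<subseteq> convex hull C"
  using v_in_convex_hull[OF A_subset]
  by (intro hull_minimal) (auto simp: star_def hull_inc)

lemma simplices_N_top: "simplices N (Suc e) = {convex hull C}"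
proof -
  have "{W. W \<subseteq> C \<and> card W = Suc (Suc e)} = {C}"
    using card_C card_subset_eq[OF finite_set[of X]] by auto
  then show ?thesis
    by (simp only: simplices_N image_insert image_empty)
qed

lemma simplices_N_facets: "simplices N e = base_facet ` C"
proof -
  have "{W. W \<subseteq> C \<and> card W = Suc e} \<subseteq> (\<lambda>c. C - {c}) ` C"
  proof
    fix W assume "W \<in> {W. W \<subseteq> C \<and> card W = Suc e}"
    then have W: "W \<subseteq> C" "card W = Suc e"
      by auto
    then have "card (C - W) = 1"
      using card_C by (simp add: card_Diff_subset finite_subset[OF W(1)])
    then obtain c where "C - W = {c}"
      by (auto simp: card_1_singleton_iff)
    then have "W = C - {c}" "c \<in> C"
      using W by blast+
    then show "W \<in> (\<lambda>c. C - {c}) ` C"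
      by (rule image_eqI)
  qed
  moreover have "(\<lambda>c. C - {c}) ` C \<subseteq> {W. W \<subseteq> C \<and> card W = Suc e}"
    using card_C by auto
  ultimately have "{W. W \<subseteq> C \<and> card W = Suc e} = (\<lambda>c. C - {c}) ` C"
    by (rule subset_antisym)
  then show ?thesis
    by (simp only: simplices_N image_image flip: base_facet_def)
qed

lemma mem_base_facet: "b \<in> C \<Longrightarrow> b \<in> base_facet c \<longleftrightarrow> b \<noteq> c"
  unfolding base_facet_def
proof
  assume "b \<in> C" "b \<in> convex hull (C - {c})"
  then show "b \<noteq> c"
    using independent_frame convex_hull_subset_affine_hull unfolding affine_dependent_def by blast
qed (auto simp: hull_inc)

text \<open>For \<open>c\<close> outside \<open>A\<close> the face contains all of \<open>A\<close>
  and hence \<open>v\<close>; for \<open>c\<close> in \<open>A\<close> even its affine hull misses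
  \<open>v\<close>.\<close>

lemma v_mem_base_facet: "c \<in> C \<Longrightarrow> v \<in> base_facet c \<longleftrightarrow> c \<notin> A"
  unfolding base_facet_def
  using v_notin_affine_hull convex_hull_subset_affine_hull v_in_convex_hull[of "C - {c}"] A_subset
  by blast

lemma inj_base_facet: "inj_on base_facet C"
  by (rule inj_onI) (metis mem_base_facet)

text \<open>Inclusion is tested on vertices: \<open>v\<close> rules out \<open>c\<close> in
  \<open>A\<close>, and a vertex \<open>b\<close> in \<open>C\<close> rules out only
  \<open>c = b\<close>. A facet thus lies in at most one codimension one face of the simplex, and a
  facet shared by two cells in none.\<close>

lemma facet_subset_base_facet_iff:
  assumes a: "a \<in> A" and u: "u \<in> star a" and c: "c \<in> C"
  shows "facet a u \<subseteq> base_facet c \<longleftrightarrow> (if u = v then c = a else c = u \<and> c \<notin> A)"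
proof -
  have "facet a u \<subseteq> base_facet c \<longleftrightarrow> star a - {u} \<subseteq> base_facet c"
    unfolding facet_def base_facet_def
    by (meson convex_convex_hull hull_subset subset_hull subset_trans)
  also have "\<dots> \<longleftrightarrow> (u \<noteq> v \<longrightarrow> v \<in> base_facet c) \<and> (\<forall>b\<in>C - {a} - {u}. b \<in> base_facet c)"
    by (auto simp: star_def)
  also have "\<dots> \<longleftrightarrow> (u \<noteq> v \<longrightarrow> c \<notin> A) \<and> (c = a \<or> c = u)"
    using c by (auto simp: v_mem_base_facet mem_base_facet)
  also have "\<dots> \<longleftrightarrow> (if u = v then c = a else c = u \<and> c \<notin> A)"
    using a c v_notin_C by auto
  finally show ?thesis .
qed

text \<open>In top degree the image of the chain map is the line spanned by the subdivided simplex,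
  with coefficient \<open>\<sigma> * cell_sign a\<close> at \<open>cell a\<close>, so orthogonality
  is a single equation.\<close>

lemma mem_subdivision_complement_iff:
  "y \<in> subdivision_complement oriN N oriM M (Suc e) \<longleftrightarrow>
     y \<in> chains M (Suc e) \<and> (\<Sum>a\<in>A. y (cell a) * cell_sign a) = 0"
proof -
  define \<sigma> where "\<sigma> = sgn (vol (oriN (convex hull C)))"
  note oriN_C = oriN_props[OF subset_refl card_C]
  have len: "length (oriN (convex hull C)) = n"
    using oriN_C card_C length_X by (metis distinct_card)
  have nz: "vol (oriN (convex hull C)) \<noteq> 0"
    using oriN_C len by (intro vol_nonzero) (auto simp: hull_inc)
  have map: "subdivision_chain_map oriN N oriM M (Suc e) w (cell a) = w (convex hull C) * \<sigma> * cell_sign a"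
    if a: "a \<in> A" for a w
  proof -
    have "relative_sign (oriN (convex hull C)) (oriM (cell a)) = \<sigma> * cell_sign a"
      using relative_sign_eq_vol[of "oriN (convex hull C)" "oriM (cell a)" "[]"] nz vol_oriM_cell[OF a]
        oriN_C len oriM_cell[OF a] star_subset_H[of a] by (simp add: \<sigma>_def cell_sign_def hull_subset)
    moreover have "{S \<in> simplices N (Suc e). cell a \<subseteq> S} = {convex hull C}"
      using convex_hull_star_subset by (auto simp: simplices_N_top cell_def)
    ultimately show ?thesis
      using a by (simp add: subdivision_chain_map_def simplices_M_top)
  qed
  have inner: "chain_inner M (Suc e) (subdivision_chain_map oriN N oriM M (Suc e) w) y =
      w (convex hull C) * \<sigma> * (\<Sum>a\<in>A. y (cell a) * cell_sign a)" for w
    unfolding chain_inner_def simplices_M_top sum.reindex[OF inj_cell]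
    by (simp add: map sum_distrib_left mult_ac)
  have ind: "(\<lambda>S. if S = convex hull C then 1 else 0) \<in> chains N (Suc e)"
    by (simp add: chains_def simplices_N_top)
  have "(\<forall>x\<in>subdivision_image oriN N oriM M (Suc e). chain_inner M (Suc e) x y = 0) \<longleftrightarrow>
      (\<Sum>a\<in>A. y (cell a) * cell_sign a) = 0"
  proof
    assume "\<forall>x\<in>subdivision_image oriN N oriM M (Suc e). chain_inner M (Suc e) x y = 0"
    then have "\<sigma> * (\<Sum>a\<in>A. y (cell a) * cell_sign a) = 0"
      unfolding subdivision_image_def using ind inner[of "\<lambda>S. if S = convex hull C then 1 else 0"] by fastforce
    then show "(\<Sum>a\<in>A. y (cell a) * cell_sign a) = 0"
      using nz by (simp add: \<sigma>_def sgn_zero_iff)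
  qed (auto simp: subdivision_image_def inner)
  then show ?thesis
    by (auto simp: subdivision_complement_def)
qed

text \<open>The three cases are a face left whole, a facet shared by two cells, and a piece of a
  subdivided face.\<close>

lemma subdivision_chain_map_facet:
  assumes a: "a \<in> A" and u: "u \<in> star a"
  shows "subdivision_chain_map oriN N oriM M e w (facet a u) =
    (if u = v then w (base_facet a) * relative_sign (oriN (base_facet a)) (oriM (base_facet a))
     else if u \<in> A then 0
     else w (base_facet u) * (sgn (vol (u # oriN (base_facet u))) * facet_sign a u))"
proof -
  have "{S \<in> simplices N e. facet a u \<subseteq> S} = base_facet ` {c \<in> C. facet a u \<subseteq> base_facet c}"
    by (auto simp: simplices_N_facets)
  also have "{c \<in> C. facet a u \<subseteq> base_facet c} = {c \<in> C. if u = v then c = a else c = u \<and> c \<notin> A}"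
    using facet_subset_base_facet_iff[OF a u] by blast
  also have "\<dots> = (if u = v then {a} else if u \<in> A then {} else {u})"
    using a u A_subset by (auto simp: star_def)
  finally have sub: "{S \<in> simplices N e. facet a u \<subseteq> S} =
      base_facet ` (if u = v then {a} else if u \<in> A then {} else {u})" .
  \<comment> \<open>The vertex \<open>u\<close> is opposite both to \<open>base_facet u\<close> in
    the simplex and to \<open>facet a u\<close> in the cell, so one prepended vertex serves both
    orderings.\<close>
  have "relative_sign (oriN (base_facet u)) (oriM (facet a u)) = sgn (vol (u # oriN (base_facet u))) * facet_sign a u"
    if u': "u \<noteq> v" "u \<notin> A"
    unfolding facet_sign_def
  proof (rule relative_sign_eq_vol_Cons)
    have u_C: "u \<in> C"
      using u u' by (auto simp: star_def)
    note N = oriN_base_facet[OF u_C]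
    show "distinct (oriN (base_facet u))" "length (oriN (base_facet u)) = length (oriM (facet a u))"
      "Suc (length (oriN (base_facet u))) = n"
      using N oriM_facet[OF a u] length_X by auto
    show "u \<in> H" "set (oriN (base_facet u)) \<subseteq> H" "set (oriM (facet a u)) \<subseteq> H"
      using u_C N oriM_facet[OF a u] star_subset_H[of a] by (auto simp: hull_inc)
    have "facet a u \<subseteq> base_facet u"
      using facet_subset_base_facet_iff[OF a u u_C] u' by simp
    then show "set (oriM (facet a u)) \<subseteq> affine hull set (oriN (base_facet u))"
      unfolding N(2) oriM_facet(2)[OF a u] unfolding facet_def base_facet_def
      by (rule order_trans[OF hull_subset order_trans[OF _ convex_hull_subset_affine_hull]])
    show "vol (u # oriN (base_facet u)) \<noteq> 0"
    proof (rule vol_nonzero)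
      have "set (u # oriN (base_facet u)) = C"
        using N(2) u_C by auto
      then show "set (u # oriN (base_facet u)) \<subseteq> H" "C \<subseteq> affine hull set (u # oriN (base_facet u))"
        by (simp_all only: hull_subset)
    qed (use N length_X in simp_all)
    show "vol (u # oriM (facet a u)) \<noteq> 0"
      by (rule incidence_facet(2)[OF a u])
  qed
  then show ?thesis
    unfolding subdivision_chain_map_def sub
    using facet_in_simplices[OF a u] facet_v[OF a] by (cases "u = v"; cases "u \<in> A") simp_all
qed

text \<open>The facets in a face that contains \<^term>\<open>A\<close> contribute a multiple of
  \<open>\<Sum>a\<in>A. y (cell a) * cell_sign a\<close>, which vanishes.\<close>

lemma chain_inner_image_bd:
  assumes x: "x \<in> subdivision_image oriN N oriM M e" and y: "(\<Sum>a\<in>A. y (cell a) * cell_sign a) = 0"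
  shows "chain_inner M e x (chain_bd oriM M e y) =
    (\<Sum>a\<in>A. y (cell a) * (cell_sign a * facet_sign a v * x (base_facet a)))"
proof -
  obtain w where w: "x = subdivision_chain_map oriN N oriM M e w"
    using x by (auto simp: subdivision_image_def)
  define r where "r = (\<Sum>c\<in>C - A. w (base_facet c) * sgn (vol (c # oriN (base_facet c))))"
  have inner: "(\<Sum>u\<in>star a. x (facet a u) * (cell_sign a * facet_sign a u)) = cell_sign a * facet_sign a v * x (base_facet a) + cell_sign a * r"
    if a: "a \<in> A" for a
  proof -
    have "(\<Sum>u\<in>star a. x (facet a u) * (cell_sign a * facet_sign a u)) =
        x (facet a v) * (cell_sign a * facet_sign a v) + (\<Sum>u\<in>C - {a}. x (facet a u) * (cell_sign a * facet_sign a u))"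
      using v_notin_C by (simp add: star_def)
    also have "(\<Sum>u\<in>C - {a}. x (facet a u) * (cell_sign a * facet_sign a u)) = (\<Sum>u\<in>C - A. x (facet a u) * (cell_sign a * facet_sign a u))"
    proof (rule sum.mono_neutral_right)
      \<comment> \<open>Facets opposite to another point of \<open>A\<close> are shared by two
        cells, and there a subdivided chain has coefficient 0.\<close>
      show "\<forall>u\<in>C - {a} - (C - A). x (facet a u) * (cell_sign a * facet_sign a u) = 0"
        using a v_notin_C by (auto simp: w subdivision_chain_map_facet star_def)
    qed (use a in auto)
    \<comment> \<open>The facet sign occurs twice and cancels; apart from \<open>cell_sign a\<close>
      the sum no longer depends on \<open>a\<close>.\<close>
    also have "\<dots> = (\<Sum>u\<in>C - A. cell_sign a * (w (base_facet u) * sgn (vol (u # oriN (base_facet u)))))"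
    proof (rule sum.cong[OF refl])
      fix u assume u: "u \<in> C - A"
      then have "u \<in> star a" "u \<noteq> v"
        using a v_notin_C by (auto simp: star_def)
      then show "x (facet a u) * (cell_sign a * facet_sign a u) = cell_sign a * (w (base_facet u) * sgn (vol (u # oriN (base_facet u))))"
        using u a facet_sign_square[OF a, of u] by (simp add: w subdivision_chain_map_facet mult_ac)
    qed
    also have "\<dots> = cell_sign a * r"
      by (simp add: r_def sum_distrib_left)
    finally show ?thesis
      using a by (simp add: facet_v mult_ac)
  qed
  have "(\<Sum>a\<in>A. y (cell a) * (cell_sign a * r)) = (\<Sum>a\<in>A. y (cell a) * cell_sign a) * r"
    by (simp add: sum_distrib_right mult.assoc)
  then show ?thesis
    unfolding chain_inner_bd by (simp add: inner distrib_left sum.distrib y)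
qed

section \<open>Chains on the faces left whole\<close>

lemma cell_facet_sign_square:
  assumes "a \<in> A"
  shows "(cell_sign a * facet_sign a v)\<^sup>2 = 1"
proof -
  have "(cell_sign a * facet_sign a v)\<^sup>2 = (cell_sign a * cell_sign a) * (facet_sign a v * facet_sign a v)"
    by (simp only: power2_eq_square mult_ac)
  then show ?thesis
    using cell_sign_square[OF assms] facet_sign_square[OF assms, of v] by (simp add: star_def)
qed

lemma base_facet_in_simplices: "a \<in> A \<Longrightarrow> base_facet a \<in> simplices M e"
  using facet_in_simplices[of a v] facet_v by (simp add: star_def)

lemma sum_base_facets_le:
  "(\<Sum>a\<in>A. (x (base_facet a))\<^sup>2) \<le> chain_inner M e x x"
proof -
  have "(\<Sum>a\<in>A. (x (base_facet a))\<^sup>2) = (\<Sum>T\<in>base_facet ` A. x T * x T)"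
    using inj_on_subset[OF inj_base_facet A_subset] by (simp add: sum.reindex power2_eq_square)
  also have "\<dots> \<le> chain_inner M e x x"
    unfolding chain_inner_def
    by (rule sum_mono2[OF finite_simplices_M]) (use base_facet_in_simplices in auto)
  finally show ?thesis .
qed

text \<open>Neither \<open>v\<close> nor \<open>c\<close> lies in this face, so the vertices of
  \<open>T\<close> are among \<open>C - {c}\<close>, and their number leaves no choice. The face
  opposite to \<open>c\<close> is thus left whole.\<close>

lemma subset_base_facetD:
  assumes T: "T \<in> simplices M e" and c: "c \<in> A" and sub: "T \<subseteq> base_facet c"
  shows "T = base_facet c"
proof -
  obtain b W where W: "b \<in> A" "W \<subseteq> star b" "card W = Suc e" "T = convex hull W"
    using T by (auto simp: simplices_M)
  have c_C: "c \<in> C"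
    using c A_subset by blast
  have "W \<subseteq> base_facet c"
    using sub W by (metis hull_subset subset_trans)
  moreover have "v \<notin> base_facet c" "c \<notin> base_facet c"
    using c c_C by (simp_all add: v_mem_base_facet mem_base_facet)
  ultimately have "W \<subseteq> C - {c}"
    using W by (auto simp: star_def)
  then have "W = C - {c}"
    using W card_C c_C by (intro card_subset_eq) auto
  then show ?thesis
    by (simp add: W base_facet_def)
qed

text \<open>The faces opposite to points of \<open>A\<close> are simplices of both complexes, so a
  chain supported on them is changed at most by signs. Serves to realise the equality case of
  Cauchy-Schwarz.\<close>

lemma exists_image_with_base_facets:
  obtains x where "x \<in> subdivision_image oriN N oriM M e" "\<And>a. a \<in> A \<Longrightarrow> x (base_facet a) = g a"
    "chain_inner M e x x = (\<Sum>a\<in>A. (g a)\<^sup>2)"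
proof -
  define \<rho> where "\<rho> a = relative_sign (oriN (base_facet a)) (oriM (base_facet a))" for a
  \<comment> \<open>The sign \<open>\<rho> a\<close> is the one by which the chain map multiplies;
    its square is 1, so the image has coefficient \<open>g a\<close>.\<close>
  define w where "w S = (\<Sum>a\<in>A. if S = base_facet a then g a * \<rho> a else 0)" for S
  define x where "x = subdivision_chain_map oriN N oriM M e w"
  have inj: "base_facet a = base_facet b \<longleftrightarrow> a = b" if "a \<in> A" "b \<in> A" for a b
    using that inj_base_facet A_subset by (auto simp: inj_on_def)
  have w: "w (base_facet a) = g a * \<rho> a" if "a \<in> A" for a
  proof -
    have "w (base_facet a) = (\<Sum>b\<in>A. if a = b then g b * \<rho> b else 0)"
      unfolding w_def using that inj by (intro sum.cong) auto
    then show ?thesis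
      using that finite_A by simp
  qed
  have x_base: "x (base_facet a) = g a" if a: "a \<in> A" for a
  proof -
    have "x (facet a v) = w (base_facet a) * \<rho> a"
      unfolding x_def \<rho>_def using subdivision_chain_map_facet[OF a, of v] by (simp add: star_def)
    then show ?thesis
      using a by (simp add: facet_v w \<rho>_def relative_sign_def)
  qed
  have x_0: "x T = 0" if T: "T \<in> simplices M e - base_facet ` A" for T
  proof -
    have "w S = 0" if S: "S \<in> simplices N e" "T \<subseteq> S" for S
      unfolding w_def using subset_base_facetD T S by (intro sum.neutral) auto
    then show ?thesis
      unfolding x_def subdivision_chain_map_def by simp
  qed
  have "base_facet a \<in> simplices N e" if "a \<in> A" for a
    using that A_subset by (auto simp: simplices_N_facets)
  then have "w \<in> chains N e"
    unfolding chains_def w_def by (auto intro!: sum.neutral)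
  then have img: "x \<in> subdivision_image oriN N oriM M e"
    by (simp add: x_def subdivision_image_def)
  have "chain_inner M e x x = (\<Sum>T\<in>base_facet ` A. x T * x T)"
    unfolding chain_inner_def
    by (rule sum.mono_neutral_right[OF finite_simplices_M]) (use base_facet_in_simplices x_0 in auto)
  also have "\<dots> = (\<Sum>a\<in>A. (g a)\<^sup>2)"
    using inj_on_subset[OF inj_base_facet A_subset] by (simp add: sum.reindex power2_eq_square x_base)
  finally show thesis
    using that img x_base by blast
qed

section \<open>The value of the maximum\<close>

lemma codim_one_invariant_eq:
  "codim_one_invariant (Suc e) oriN N oriM M = 1 / sqrt (real (Suc e) + 2)"
proof -
  define s where "s = sqrt (real (Suc e) + 2)"
  have s: "s > 0" "s * s = real (Suc e) + 2" "s\<^sup>2 = real (Suc e) + 2"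
    unfolding s_def by auto
  define D where "D = chain_bd oriM M e"
  have "max_inner (chain_inner M e) (subdivision_image oriN N oriM M e)
      (D ` subdivision_complement oriN N oriM M (Suc e)) = 1 / s"
    unfolding max_inner_def
  proof (rule Greatest_equality)
    obtain p q where pq: "p \<in> A" "q \<in> A" "p \<noteq> q"
      using two_le_card_A by (metis One_nat_def Suc_1 card_le_Suc0_iff_eq finite_A not_less_eq_eq)
    \<comment> \<open>After compatible orientation, opposite coefficients on two cells, hence an
      element of the complement. The denominator makes the squares add up to
      \<open>1 / s\<^sup>2\<close>, so that \<open>D y\<close> has norm 1.\<close>
    define y where "y T = (if T = cell p then cell_sign p / (sqrt 2 * s) else if T = cell q then - cell_sign q / (sqrt 2 * s) else 0)"
      for T
    have y_cell: "y (cell a) = (if a = p then cell_sign p / (sqrt 2 * s) else if a = q then - cell_sign q / (sqrt 2 * s) else 0)"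
      if "a \<in> A" for a
      using that pq inj_cell by (auto simp: y_def inj_on_def)
    have reduce: "(\<Sum>a\<in>A. f a) = f p + f q" if "\<And>a. a \<in> A - {p, q} \<Longrightarrow> f a = 0" for f :: "'a \<Rightarrow> real"
    proof -
      have "sum f A = sum f {p, q}"
        using that pq by (intro sum.mono_neutral_right finite_A) auto
      then show ?thesis
        using pq by simp
    qed
    have sq: "(cell_sign a / (sqrt 2 * s))\<^sup>2 = 1 / (2 * s\<^sup>2)" if "a \<in> A" for a
      using cell_sign_square[OF that] by (simp add: power2_eq_square field_simps)
    have y0: "(\<Sum>a\<in>A. y (cell a) * cell_sign a) = 0"
      using pq by (subst reduce) (auto simp: y_cell cell_sign_square)
    have y2: "(\<Sum>a\<in>A. (y (cell a))\<^sup>2) = 1 / s\<^sup>2"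
      using pq sq by (subst reduce) (auto simp: y_cell)
    have y_mem: "y \<in> subdivision_complement oriN N oriM M (Suc e)"
      using y0 pq by (auto simp: mem_subdivision_complement_iff chains_def simplices_M_top y_def)
    have yD: "chain_inner M e (D y) (D y) = 1"
      unfolding D_def chain_inner_bd_bd[OF y0] y2 using s by simp
    \<comment> \<open>The equality case of Cauchy-Schwarz: on the faces left whole, \<open>x\<close>
      is proportional to the coefficients there of \<open>D y\<close>, and the factor
      \<open>s\<close> gives it norm 1.\<close>
    obtain x where x: "x \<in> subdivision_image oriN N oriM M e"
      "\<And>a. a \<in> A \<Longrightarrow> x (base_facet a) = s * (y (cell a) * (cell_sign a * facet_sign a v))"
      "chain_inner M e x x = (\<Sum>a\<in>A. (s * (y (cell a) * (cell_sign a * facet_sign a v)))\<^sup>2)"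
      using exists_image_with_base_facets[of "\<lambda>a. s * (y (cell a) * (cell_sign a * facet_sign a v))"] by blast
    have "chain_inner M e x x = s\<^sup>2 * (\<Sum>a\<in>A. (y (cell a))\<^sup>2)"
      unfolding x(3) by (simp add: power_mult_distrib[of s] power_mult_distrib[of "y _"] cell_facet_sign_square sum_distrib_left)
    then have xx: "chain_inner M e x x = 1"
      using s by (simp add: y2)
    have "chain_inner M e x (D y) = (\<Sum>a\<in>A. s * (y (cell a))\<^sup>2)"
      unfolding D_def chain_inner_image_bd[OF x(1) y0]
    proof (rule sum.cong[OF refl])
      fix a assume a: "a \<in> A"
      have "y (cell a) * (cell_sign a * facet_sign a v * x (base_facet a)) = s * (y (cell a))\<^sup>2 * (cell_sign a * facet_sign a v)\<^sup>2"
        by (simp only: x(2)[OF a] power2_eq_square mult_ac)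
      then show "y (cell a) * (cell_sign a * facet_sign a v * x (base_facet a)) = s * (y (cell a))\<^sup>2"
        by (simp add: cell_facet_sign_square[OF a])
    qed
    also have "\<dots> = 1 / s"
      unfolding sum_distrib_left[symmetric] y2 using s(1) by (simp add: power2_eq_square)
    finally show "\<exists>x\<in>subdivision_image oriN N oriM M e. \<exists>y\<in>D ` subdivision_complement oriN N oriM M (Suc e).
        sqrt (chain_inner M e x x) = 1 \<and> sqrt (chain_inner M e y y) = 1 \<and> 1 / s = chain_inner M e x y"
      using x(1) y_mem xx yD by (intro bexI[of _ x] bexI[of _ "D y"]) auto
  next
    fix r assume "\<exists>x\<in>subdivision_image oriN N oriM M e. \<exists>y\<in>D ` subdivision_complement oriN N oriM M (Suc e).
        sqrt (chain_inner M e x x) = 1 \<and> sqrt (chain_inner M e y y) = 1 \<and> r = chain_inner M e x y"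
    then obtain x y where x: "x \<in> subdivision_image oriN N oriM M e" "chain_inner M e x x = 1"
      and y: "y \<in> subdivision_complement oriN N oriM M (Suc e)" "chain_inner M e (D y) (D y) = 1"
      and r: "r = chain_inner M e x (D y)"
      by (auto simp: real_sqrt_eq_1_iff)
    have y0: "(\<Sum>a\<in>A. y (cell a) * cell_sign a) = 0"
      using y(1) by (simp add: mem_subdivision_complement_iff)
    have y2: "(\<Sum>a\<in>A. (y (cell a))\<^sup>2) = (1 / s)\<^sup>2"
      using y(2) s unfolding D_def chain_inner_bd_bd[OF y0] by (simp add: power_divide field_simps)
    \<comment> \<open>Only the coordinates of \<open>x\<close> on the faces left whole enter the
      pairing, so Cauchy-Schwarz is applied to these alone; they contribute at most the norm of
      \<open>x\<close>.\<close>
    have "r\<^sup>2 \<le> (\<Sum>a\<in>A. (y (cell a))\<^sup>2) * (\<Sum>a\<in>A. (cell_sign a * facet_sign a v * x (base_facet a))\<^sup>2)"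
      unfolding r D_def chain_inner_image_bd[OF x(1) y0] by (rule Cauchy_Schwarz_ineq_sum)
    also have "(\<Sum>a\<in>A. (cell_sign a * facet_sign a v * x (base_facet a))\<^sup>2) = (\<Sum>a\<in>A. (x (base_facet a))\<^sup>2)"
      by (intro sum.cong refl) (simp add: power_mult_distrib[of "cell_sign _ * facet_sign _ v"] cell_facet_sign_square)
    also have "(\<Sum>a\<in>A. (y (cell a))\<^sup>2) * (\<Sum>a\<in>A. (x (base_facet a))\<^sup>2) \<le> (1 / s)\<^sup>2 * 1"
      unfolding y2 using sum_base_facets_le[of x] x(2) by (intro mult_left_mono) auto
    finally show "r \<le> 1 / s"
      using s(1) by (intro power2_le_imp_le[of r "1 / s"]) auto
  qed
  then show ?thesis
    by (simp add: codim_one_invariant_def D_def s_def)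
qed

end

section \<open>Elementary stellar subdivisions of a simplex\<close>

text \<open>Brings the subdivision into the form required by \<open>stellar_simplex\<close>: the
  base of the cone consists of the faces that do not contain all of \<open>A\<close>.\<close>

lemma stellar_subdivision_simplex:
  fixes C A :: "'a::euclidean_space set"
  assumes C: "\<not> affine_dependent C" and A: "A \<subseteq> C"
    and K: "K = {F. F face_of convex hull C}"
  shows "stellar_subdivision K (convex hull A) v =
    {convex hull W | W. \<exists>a\<in>A. W \<subseteq> insert v (C - {a})}"
proof -
  have indep: "\<not> affine_dependent W" if "W \<subseteq> C" for W
    using C that affine_independent_subset by blast
  have eq_iff: "convex hull W = convex hull W' \<longleftrightarrow> W = W'" if "W \<subseteq> C" "W' \<subseteq> C" for W W'
    using indep[OF that(1)] indep[OF that(2)] simplex_vertices_convex_hull by metis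
  have K_eq: "K = {convex hull W | W. W \<subseteq> C}"
    unfolding K face_of_convex_hull_affine_independent[OF C] by blast
  have A_face: "convex hull A face_of convex hull C"
    unfolding face_of_convex_hull_affine_independent[OF C] using A by blast
  have C_in_K: "convex hull C \<in> K"
    by (simp add: K face_of_refl)
  \<comment> \<open>The top simplex contains the subdivided face and has every element of
    \<open>K\<close> as a face, so nothing of \<open>K\<close> lies outside the star.\<close>
  have star: "closed_star K (convex hull A) = K"
  proof
    show "closed_star K (convex hull A) \<subseteq> K"
      unfolding closed_star_def K using face_of_trans by blast
    show "K \<subseteq> closed_star K (convex hull A)"
    proof
      fix F assume "F \<in> K"
      then have "F face_of convex hull C"
        by (simp add: K)
      then show "F \<in> closed_star K (convex hull A)"
        unfolding closed_star_def using C_in_K A_face by blast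
    qed
  qed
  \<comment> \<open>Faces of a simplex intersect in the hull of their common vertices, by affine
    independence.\<close>
  have disj: "convex hull W \<inter> convex hull A = {} \<longleftrightarrow> W \<inter> A = {}" if "W \<subseteq> C" for W
  proof -
    have "convex hull W \<inter> convex hull A = convex hull (W \<inter> A)"
      using that A by (intro convex_hull_Int[symmetric] indep) simp
    then show ?thesis
      by simp
  qed
  have hull_union: "convex hull (convex hull F \<union> convex hull G) = convex hull (F \<union> G)" for F G :: "'a set"
    using hull_Un[of convex F G] by (simp add: convex_Inter)
  have link: "simplex_link K (convex hull A) = {convex hull G | G. G \<subseteq> C - A}"
  proof -
    have "W \<subseteq> C \<and> convex hull W \<inter> convex hull A = {} \<longleftrightarrow> W \<subseteq> C - A" for W
      using disj[of W] by auto
    moreover have "simplex_link K (convex hull A) =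
        {convex hull W | W. W \<subseteq> C \<and> convex hull W \<inter> convex hull A = {}}"
      unfolding simplex_link_def star unfolding K_eq by auto
    ultimately show ?thesis
      by (simp only:)
  qed
  have bd: "boundary_complex (convex hull A) = {convex hull F | F. F \<subseteq> A \<and> F \<noteq> A}"
  proof -
    have "F \<subseteq> A \<and> convex hull F \<noteq> convex hull A \<longleftrightarrow> F \<subseteq> A \<and> F \<noteq> A" for F
      using eq_iff[OF subset_trans[OF _ A] A, of F] by blast
    moreover have "boundary_complex (convex hull A) =
        {convex hull F | F. F \<subseteq> A \<and> convex hull F \<noteq> convex hull A}"
      unfolding boundary_complex_def face_of_convex_hull_affine_independent[OF indep[OF A]] by auto
    ultimately show ?thesis
      by (simp only:)
  qed
  \<comment> \<open>A vertex set \<open>B\<close> splits into \<open>B \<inter> A\<close> and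
    \<open>B - A\<close>; the former spans a proper face of the subdivided face exactly if
    \<open>B\<close> omits a point of \<open>A\<close>.\<close>
  have join: "complex_join (boundary_complex (convex hull A)) (simplex_link K (convex hull A)) =
      {convex hull B | B. B \<subseteq> C \<and> \<not> A \<subseteq> B}" (is "?J = ?R")
  proof
    show "?J \<subseteq> ?R"
    proof
      fix T assume "T \<in> ?J"
      then obtain F G where "F \<subseteq> A" "F \<noteq> A" "G \<subseteq> C - A"
        "T = convex hull (convex hull F \<union> convex hull G)"
        unfolding complex_join_def bd link by blast
      then have "F \<union> G \<subseteq> C" "\<not> A \<subseteq> F \<union> G"
        using A by blast+
      moreover have "T = convex hull (F \<union> G)"
        unfolding \<open>T = _\<close> by (rule hull_union)
      ultimately show "T \<in> ?R"
        by blast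
    qed
    show "?R \<subseteq> ?J"
    proof
      fix T assume "T \<in> ?R"
      then obtain B where B: "T = convex hull B" "B \<subseteq> C" "\<not> A \<subseteq> B"
        by blast
      have "convex hull (convex hull (B \<inter> A) \<union> convex hull (B - A)) = convex hull ((B \<inter> A) \<union> (B - A))"
        by (rule hull_union)
      then have "T = convex hull (convex hull (B \<inter> A) \<union> convex hull (B - A))"
        using B by (simp add: Int_Diff_Un)
      moreover have "B \<inter> A \<subseteq> A" "B \<inter> A \<noteq> A" "B - A \<subseteq> C - A"
        using B by auto
      ultimately show "T \<in> ?J"
        unfolding complex_join_def bd link by blast
    qed
  qed
  have cone: "{convex hull (insert v F) | F. F \<in> {convex hull B | B. B \<subseteq> C \<and> \<not> A \<subseteq> B}} =
      {convex hull (insert v B) | B. B \<subseteq> C \<and> \<not> A \<subseteq> B}"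
  proof -
    have "convex hull (insert v (convex hull B)) = convex hull (insert v B)" for B
      using hull_insert[of convex v B] by (simp add: convex_Inter)
    moreover have "{convex hull (insert v F) | F. F \<in> {convex hull B | B. B \<subseteq> C \<and> \<not> A \<subseteq> B}} =
        {convex hull (insert v (convex hull B)) | B. B \<subseteq> C \<and> \<not> A \<subseteq> B}"
      by blast
    ultimately show ?thesis
      by (simp only:)
  qed
  have "stellar_subdivision K (convex hull A) v =
      {convex hull B | B. B \<subseteq> C \<and> \<not> A \<subseteq> B} \<union> {convex hull (insert v B) | B. B \<subseteq> C \<and> \<not> A \<subseteq> B}"
    unfolding stellar_subdivision_def star join cone_over_def cone
    by (simp only: Diff_cancel Un_empty_left)
  \<comment> \<open>Omitting a point of \<open>A\<close> means lying in some \<open>C - {a}\<close>;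
    the two parts of the union account for the sets \<open>W\<close> without and with
    \<open>v\<close>.\<close>
  also have "\<dots> = {convex hull W | W. \<exists>a\<in>A. W \<subseteq> insert v (C - {a})}" (is "?L1 \<union> ?L2 = ?M")
  proof
    show "?L1 \<union> ?L2 \<subseteq> ?M"
      by blast
    show "?M \<subseteq> ?L1 \<union> ?L2"
    proof
      fix T assume "T \<in> ?M"
      then obtain W a where W: "T = convex hull W" "a \<in> A" "W \<subseteq> insert v (C - {a})"
        by blast
      show "T \<in> ?L1 \<union> ?L2"
      proof (cases "v \<in> W")
        case True
        then have "W = insert v (W \<inter> (C - {a}))"
          using W by blast
        then have "T = convex hull (insert v (W \<inter> (C - {a})))"
          using W by simp
        moreover have "W \<inter> (C - {a}) \<subseteq> C" "\<not> A \<subseteq> W \<inter> (C - {a})"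
          using W by auto
        ultimately show ?thesis
          by blast
      next
        case False
        then show ?thesis
          using W by blast
      qed
    qed
  qed
  finally show ?thesis .
qed

lemma codim_one_invariant_stellar:
  fixes N M :: "'a::euclidean_space set set"
  assumes N: "isolated_simplex d N" and M: "elementary_stellar_subdivision k N M"
    and ori: "complex_orientation N oriN" "complex_orientation M oriM"
  shows "codim_one_invariant d oriN N oriM M = 1 / sqrt (real d + 2)"
proof -
  obtain C where C: "\<not> affine_dependent C" "card C = Suc d" and N_faces: "N = {F. F face_of convex hull C}"
    using N by (auto simp: isolated_simplex_def simplex_def)
  obtain s v where s: "s \<in> N" "v \<in> rel_interior s" "int k simplex s" "1 \<le> k" "M = stellar_subdivision N s v"
    using M by (auto simp: elementary_stellar_subdivision_def)
  obtain A where A: "A \<subseteq> C" "s = convex hull A"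
    using s(1) by (auto simp: N_faces face_of_convex_hull_affine_independent[OF C(1)])
  have indep_A: "\<not> affine_dependent A"
    using C(1) A(1) affine_independent_subset by blast
  have card_A: "card A = Suc k"
    using s(3) A(2) simplex_convex_hull_iff[OF indep_A] by blast
  \<comment> \<open>Points of the relative interior have only positive coordinates, which is what
    allows \<open>v\<close> to replace any vertex in \<open>A\<close>.\<close>
  obtain t where t: "\<forall>b\<in>A. 0 < t b" "sum t A = 1" "(\<Sum>b\<in>A. t b *\<^sub>R b) = v"
    using s(2) A(2) by (auto simp: rel_interior_convex_hull_explicit[OF indep_A])
  have fin: "finite C"
    using C(1) aff_independent_finite by blast
  obtain X where X: "set X = C" "distinct X"
    using finite_distinct_list[OF fin] by blast
  have "Suc k \<le> Suc d"
    using card_mono[OF fin A(1)] C(2) card_A by simp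
  \<comment> \<open>From \<open>k\<close> at least 1 follows \<open>d\<close> at least 1, so that
    \<open>d - 1\<close> in the invariant is not truncated.\<close>
  then obtain e where e: "d = Suc e"
    using s(4) by (cases d) auto
  interpret stellar_simplex X A t v e N M oriN oriM
  proof
    show "length X = Suc (Suc e)"
      using X C(2) e by (metis distinct_card)
    show "M = {convex hull W | W. \<exists>a\<in>A. W \<subseteq> insert v (set X - {a})}"
      unfolding s(5) A(2) X(1) by (rule stellar_subdivision_simplex[OF C(1) A(1) N_faces])
    show "N = {convex hull W | W. W \<subseteq> set X}"
      unfolding N_faces X(1) face_of_convex_hull_affine_independent[OF C(1)] by blast
  qed (use X C A card_A s(4) t ori in auto)
  show ?thesis
    using codim_one_invariant_eq unfolding e .
qed

theorem proposition6p10: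
  fixes N M :: "'a::euclidean_space set set"
    and oriN oriM :: "'a set \<Rightarrow> 'a list"
    and d k :: nat
  assumes "isolated_simplex d N"
    and "elementary_stellar_subdivision k N M"
    and "complex_orientation N oriN"
    and "complex_orientation M oriM"
  shows "codim_one_invariant d oriN N oriM M = 1 / sqrt (real d + 2) \<and>
    (\<forall>(N' :: 'a set set) M' k' oriN' oriM'.
       isolated_simplex d N' \<and> elementary_stellar_subdivision k' N' M' \<and>
       complex_orientation N' oriN' \<and> complex_orientation M' oriM' \<longrightarrow>
       codim_one_invariant d oriN' N' oriM' M' = codim_one_invariant d oriN N oriM M)"
proof (intro conjI allI impI)
  note eq = codim_one_invariant_stellar[OF assms]
  show "codim_one_invariant d oriN N oriM M = 1 / sqrt (real d + 2)"
    by (rule eq)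
  show "codim_one_invariant d oriN' N' oriM' M' = codim_one_invariant d oriN N oriM M"
    if "isolated_simplex d N' \<and> elementary_stellar_subdivision k' N' M' \<and>
       complex_orientation N' oriN' \<and> complex_orientation M' oriM'" for N' M' k' oriN' oriM'
    unfolding eq using that by (intro codim_one_invariant_stellar) auto
qed

end
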